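(* Fix $L,M,\varepsilon>0$. Let $\boldsymbol v:[0,T]\times\mathbb R^n\to\mathbb R^N$ be a bounded, $\widehat{\boldsymbol x}$-uniformly continuous Borel vector field with $v_0\equiv1$, let $\mathbf Z:[0,T]\times\mathfrak A\to[0,T]\times\mathbb R^n$ be a Borel multi-flow of $\boldsymbol v$ with dense image, and let $A\subset\mathfrak A$ be such that the flow-tube $\mathcal K=\mathbf Z([0,T]\times A)$ is compact in $[0,T]\times\mathbb R^n$. Let $\phi:\mathcal K\to\mathbb R$ be a Borel function which is $M$-Lipschitz continuous for the Euclidean distance and $L$-directionally Lipschitz continuous. Then $\phi$ admits an extension $\widetilde\phi:[0,T]\times\mathbb R^n\to\mathbb R$ which is Lipschitz continuous for the Euclidean distance and $(L+\varepsilon)$-directionally Lipschitz continuous.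
   Context: Setting. Fix $T>0$, $n\ge1$, $N=n+1$; points of $\mathbb R^N=\mathbb R\times\mathbb R^n$ are written $\boldsymbol x=(x_0,\widehat{\boldsymbol x})$. $\boldsymbol v=(v_0,\widehat{\boldsymbol v}):[0,T]\times\mathbb R^n\to\mathbb R^N$ is a bounded Borel vector field with $v_0\equiv1$, and $\|\boldsymbol v\|_\infty=\sup|\boldsymbol v|$. $\widehat{\boldsymbol x}$-uniform continuity: for every $\rho>0$ there is $\delta=\delta(\rho)>0$ such that for $\mathcal L^1$-a.e. $x_0\in[0,T]$: $|\boldsymbol v(x_0,\widehat{\boldsymbol x})-\boldsymbol v(x_0,\widehat{\boldsymbol x}')|\le\rho$ whenever $|\widehat{\boldsymbol x}-\widehat{\boldsymbol x}'|\le\delta$. Multi-flow: a Borel map $\mathbf Z:[0,T]\times\mathfrak A\to[0,T]\times\mathbb R^n$ ($\mathfrak A$ a space of parameters) such that the $0$-component satisfies $Z_0(s,\mathfrak a)=s$ for all $s\in[0,T]$, $\mathfrak a\in\mathfrak A$, and $\partial_s\mathbf Z(s,\mathfrak a)=\boldsymbol v(\mathbf Z(s,\mathfrak a))$ in $\mathcal D'((0,T))$ for every $\mathfrak a$ (so each $s\mapsto\mathbf Z(s,\mathfrak a)$ is an integral curve of $\boldsymbol v$, in particular Lipschitz). A flow-tube is a set of the form $\mathbf Z([0,T]\times A)$ with $A\subset\mathfrak A$. Competitor joining $\boldsymbol x$ and $\boldsymbol y$: a Lipschitz curve $\boldsymbol\gamma:I_{\boldsymbol\gamma}=[0,S_{\boldsymbol\gamma}]\to[0,T]\times\mathbb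 R^n$ whose endpoints $\boldsymbol\gamma(0),\boldsymbol\gamma(S_{\boldsymbol\gamma})$ are $\boldsymbol x,\boldsymbol y$ in one of the two orders, together with a finite subdivision $0=S^0\le\dots\le S^{I+1}=S_{\boldsymbol\gamma}$ such that on each $[S^i,S^{i+1}]$: (1) either $\gamma_0$ is constant and $|\dot{\boldsymbol\gamma}|\le\|\boldsymbol v\|_\infty$; (2) or $\boldsymbol\gamma(s)=\mathbf Z(\gamma_0(s),\mathfrak a_i)$ for some $\mathfrak a_i\in\mathfrak A$ and $\dot\gamma_0=1$; (3) or $\boldsymbol\gamma(s)=\mathbf Z(\gamma_0(s),\mathfrak a_i)$ for some $\mathfrak a_i\in\mathfrak A$ and $\dot\gamma_0=-1$. Let $I^{\parallel\complement}_{\boldsymbol\gamma}$ be the union of the intervals of kind (1) and $I^{\parallel}_{\boldsymbol\gamma}$ the union of those of kinds (2) and (3). Distances: for $0<\lambda\le1$, $\mathbb M_\lambda(\boldsymbol\gamma)=\mathcal L^1(I^{\parallel}_{\boldsymbol\gamma})+\frac1\lambda\mathcal L^1(I^{\parallel\complement}_{\boldsymbol\gamma})$, $d_\lambda(\boldsymbol x,\boldsymbol y)=\inf\{\mathbb M_\lambda(\boldsymbol\gamma):\boldsymbol\gamma\text{ competitor joining }\boldsymbol x\text{ and }\boldsymbol y\}$, and $d_0(\boldsymbol x,\boldsymbol y)=\sup_{0<\lambda\le1}d_\lambda(\boldsymbol x,\boldsymbol y)=\lim_{\lambda\downarrow0}d_\lambda(\boldsymbol x,\boldsymbol y)\in[0,+\infty]$,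 for $\boldsymbol x,\boldsymbol y\in[0,T]\times\mathbb R^n$. Directional Lipschitz continuity: for a Borel set $D\subset[0,T]\times\mathbb R^n$, a function $\phi:D\to\mathbb R$ is $L$-directionally Lipschitz continuous if $|\phi(\boldsymbol y)-\phi(\boldsymbol x)|\le L\,d_0(\boldsymbol x,\boldsymbol y)$ for all $\boldsymbol x,\boldsymbol y\in D$. *)

theory Defs
  imports "HOL-Analysis.Analysis"
begin

text \<open>
  Points of \<open>\<real> \<times> \<real>\<^sup>n\<close> are pairs of type \<^typ>\<open>real \<times> (real ^ 'n)\<close>; the norm of the product type
  is the Euclidean one. Functions defined on part of a space (a vector field on \<open>[0,T] \<times> \<real>\<^sup>n\<close>, a
  multi-flow, ...) are total functions whose values outside that part are never used.
\<close>

abbreviation slab :: "real \<Rightarrow> (real \<times> (real ^ 'n)) set" where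
  "slab T \<equiv> {0..T} \<times> UNIV"

definition sup_norm :: "real \<Rightarrow> (real \<times> (real ^ 'n) \<Rightarrow> real \<times> (real ^ 'n)) \<Rightarrow> real" where
  "sup_norm T v = (SUP x\<in>slab T. norm (v x))"

definition bounded_Borel_field :: "real \<Rightarrow> (real \<times> (real ^ 'n) \<Rightarrow> real \<times> (real ^ 'n)) \<Rightarrow> bool" where
  "bounded_Borel_field T v \<longleftrightarrow>
     v \<in> borel_measurable (restrict_space borel (slab T)) \<and> bounded (v ` slab T)"

definition space_unif_continuous :: "real \<Rightarrow> (real \<times> (real ^ 'n) \<Rightarrow> real \<times> (real ^ 'n)) \<Rightarrow> bool" where
  "space_unif_continuous T v \<longleftrightarrow>
     (\<forall>\<rho>>0. \<exists>\<delta>>0. AE t in lborel. t \<in> {0..T} \<longrightarrow>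
        (\<forall>x x'. norm (x - x') \<le> \<delta> \<longrightarrow> norm (v (t, x) - v (t, x')) \<le> \<rho>))"

definition test_function :: "real \<Rightarrow> real \<Rightarrow> (real \<Rightarrow> real) \<Rightarrow> bool" where
  "test_function a b \<eta> \<longleftrightarrow>
     (\<forall>k t. ((deriv ^^ k) \<eta>) differentiable (at t)) \<and>
     compact (closure {t. \<eta> t \<noteq> 0}) \<and> closure {t. \<eta> t \<noteq> 0} \<subseteq> {a<..<b}"

definition locally_integrable :: "real \<Rightarrow> real \<Rightarrow> (real \<Rightarrow> 'b::euclidean_space) \<Rightarrow> bool" where
  "locally_integrable a b f \<longleftrightarrow> (\<forall>c d. a < c \<and> d < b \<longrightarrow> set_integrable lborel {c..d} f)"

text \<open>\<open>f' = g\<close> in \<open>\<D>'((a,b))\<close>, both sides being regular distributions.\<close>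

definition has_distributional_derivative ::
    "real \<Rightarrow> real \<Rightarrow> (real \<Rightarrow> 'b::euclidean_space) \<Rightarrow> (real \<Rightarrow> 'b) \<Rightarrow> bool" where
  "has_distributional_derivative a b f g \<longleftrightarrow>
     locally_integrable a b f \<and> locally_integrable a b g \<and>
     (\<forall>\<eta>. test_function a b \<eta> \<longrightarrow>
        (LINT s:{a<..<b}|lborel. deriv \<eta> s *\<^sub>R f s) = - (LINT s:{a<..<b}|lborel. \<eta> s *\<^sub>R g s))"

text \<open>
  The parameter space is a subset \<open>P\<close> of a topological space. The distributional equation alone
  determines \<open>Z (\<cdot>, a)\<close> only up to a null set of times; that \<open>Z (\<cdot>, a)\<close> is the Lipschitz
  representative is therefore part of the definition.
\<close>

definition multi_flow ::
    "real \<Rightarrow> (real \<times> (real ^ 'n) \<Rightarrow> real \<times> (real ^ 'n)) \<Rightarrow> 'a::topological_space set \<Rightarrow>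
     (real \<times> 'a \<Rightarrow> real \<times> (real ^ 'n)) \<Rightarrow> bool" where
  "multi_flow T v P Z \<longleftrightarrow>
     Z \<in> borel_measurable (restrict_space borel ({0..T} \<times> P)) \<and>
     (\<forall>s\<in>{0..T}. \<forall>a\<in>P. fst (Z (s, a)) = s) \<and>
     (\<forall>a\<in>P. (\<exists>C. C-lipschitz_on {0..T} (\<lambda>s. Z (s, a))) \<and>
        has_distributional_derivative 0 T (\<lambda>s. Z (s, a)) (\<lambda>s. v (Z (s, a))))"

definition flow_tube :: "real \<Rightarrow> (real \<times> 'a \<Rightarrow> real \<times> (real ^ 'n)) \<Rightarrow> 'a set \<Rightarrow> (real \<times> (real ^ 'n)) set" where
  "flow_tube T Z A = Z ` ({0..T} \<times> A)"

text \<open>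
  The kinds of pieces of a competitor on an interval \<open>[a,b]\<close>. Competitors are Lipschitz, so
  conditions on derivatives are required almost everywhere. An interval with \<open>a < b\<close> is of at most
  one kind; an interval with \<open>a = b\<close> may be of several, but is a null set.
\<close>

definition transversal_piece ::
    "real \<Rightarrow> (real \<times> (real ^ 'n) \<Rightarrow> real \<times> (real ^ 'n)) \<Rightarrow> (real \<Rightarrow> real \<times> (real ^ 'n)) \<Rightarrow>
     real \<Rightarrow> real \<Rightarrow> bool" where
  "transversal_piece T v \<gamma> a b \<longleftrightarrow>
     (\<forall>s\<in>{a..b}. fst (\<gamma> s) = fst (\<gamma> a)) \<and>
     (AE s in lborel. s \<in> {a<..<b} \<longrightarrow>
        (\<exists>d. (\<gamma> has_vector_derivative d) (at s) \<and> norm d \<le> sup_norm T v))"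

text \<open>\<open>\<sigma> = 1\<close>: forward in time; \<open>\<sigma> = -1\<close>: backward in time.\<close>

definition flow_piece ::
    "'a set \<Rightarrow> (real \<times> 'a \<Rightarrow> real \<times> (real ^ 'n)) \<Rightarrow> real \<Rightarrow> (real \<Rightarrow> real \<times> (real ^ 'n)) \<Rightarrow>
     real \<Rightarrow> real \<Rightarrow> bool" where
  "flow_piece P Z \<sigma> \<gamma> a b \<longleftrightarrow>
     (\<exists>p\<in>P. \<forall>s\<in>{a..b}. \<gamma> s = Z (fst (\<gamma> s), p)) \<and>
     (AE s in lborel. s \<in> {a<..<b} \<longrightarrow> ((\<lambda>r. fst (\<gamma> r)) has_real_derivative \<sigma>) (at s))"

definition parallel_piece ::
    "'a set \<Rightarrow> (real \<times> 'a \<Rightarrow> real \<times> (real ^ 'n)) \<Rightarrow> (real \<Rightarrow> real \<times> (real ^ 'n)) \<Rightarrow>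
     real \<Rightarrow> real \<Rightarrow> bool" where
  "parallel_piece P Z \<gamma> a b \<longleftrightarrow> flow_piece P Z 1 \<gamma> a b \<or> flow_piece P Z (-1) \<gamma> a b"

text \<open>
  A competitor is a curve \<open>\<gamma>\<close> together with its subdivision \<open>0 = t 0 \<le> \<dots> \<le> t (I + 1)\<close>; the
  parameter interval of \<open>\<gamma>\<close> is \<open>[0, t (I + 1)]\<close>.
\<close>

definition competitor ::
    "real \<Rightarrow> (real \<times> (real ^ 'n) \<Rightarrow> real \<times> (real ^ 'n)) \<Rightarrow> 'a set \<Rightarrow>
     (real \<times> 'a \<Rightarrow> real \<times> (real ^ 'n)) \<Rightarrow> real \<times> (real ^ 'n) \<Rightarrow> real \<times> (real ^ 'n) \<Rightarrow>
     (real \<Rightarrow> real \<times> (real ^ 'n)) \<Rightarrow> nat \<Rightarrow> (nat \<Rightarrow> real) \<Rightarrow> bool" where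
  "competitor T v P Z x y \<gamma> I t \<longleftrightarrow>
     t 0 = 0 \<and> (\<forall>i\<le>I. t i \<le> t (i + 1)) \<and>
     (\<exists>C. C-lipschitz_on {0..t (I + 1)} \<gamma>) \<and>
     \<gamma> ` {0..t (I + 1)} \<subseteq> slab T \<and>
     (\<gamma> 0 = x \<and> \<gamma> (t (I + 1)) = y \<or> \<gamma> 0 = y \<and> \<gamma> (t (I + 1)) = x) \<and>
     (\<forall>i\<le>I. transversal_piece T v \<gamma> (t i) (t (i + 1)) \<or> parallel_piece P Z \<gamma> (t i) (t (i + 1)))"

definition transversal_set ::
    "real \<Rightarrow> (real \<times> (real ^ 'n) \<Rightarrow> real \<times> (real ^ 'n)) \<Rightarrow> (real \<Rightarrow> real \<times> (real ^ 'n)) \<Rightarrow>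
     nat \<Rightarrow> (nat \<Rightarrow> real) \<Rightarrow> real set" where
  "transversal_set T v \<gamma> I t =
     (\<Union>i\<in>{i. i \<le> I \<and> transversal_piece T v \<gamma> (t i) (t (i + 1))}. {t i..t (i + 1)})"

definition parallel_set ::
    "'a set \<Rightarrow> (real \<times> 'a \<Rightarrow> real \<times> (real ^ 'n)) \<Rightarrow> (real \<Rightarrow> real \<times> (real ^ 'n)) \<Rightarrow>
     nat \<Rightarrow> (nat \<Rightarrow> real) \<Rightarrow> real set" where
  "parallel_set P Z \<gamma> I t =
     (\<Union>i\<in>{i. i \<le> I \<and> parallel_piece P Z \<gamma> (t i) (t (i + 1))}. {t i..t (i + 1)})"

definition weighted_length ::
    "real \<Rightarrow> (real \<times> (real ^ 'n) \<Rightarrow> real \<times> (real ^ 'n)) \<Rightarrow> 'a set \<Rightarrow>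
     (real \<times> 'a \<Rightarrow> real \<times> (real ^ 'n)) \<Rightarrow> real \<Rightarrow>
     (real \<Rightarrow> real \<times> (real ^ 'n)) \<Rightarrow> nat \<Rightarrow> (nat \<Rightarrow> real) \<Rightarrow> ennreal" where
  "weighted_length T v P Z lam \<gamma> I t =
     emeasure lborel (parallel_set P Z \<gamma> I t)
     + ennreal (1 / lam) * emeasure lborel (transversal_set T v \<gamma> I t)"

text \<open>The infimum of the empty set is \<open>\<infinity>\<close>.\<close>

definition dist_lam ::
    "real \<Rightarrow> (real \<times> (real ^ 'n) \<Rightarrow> real \<times> (real ^ 'n)) \<Rightarrow> 'a set \<Rightarrow>
     (real \<times> 'a \<Rightarrow> real \<times> (real ^ 'n)) \<Rightarrow> real \<Rightarrow>
     real \<times> (real ^ 'n) \<Rightarrow> real \<times> (real ^ 'n) \<Rightarrow> ennreal" where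
  "dist_lam T v P Z lam x y =
     Inf {weighted_length T v P Z lam \<gamma> I t | \<gamma> I t. competitor T v P Z x y \<gamma> I t}"

definition dist_zero ::
    "real \<Rightarrow> (real \<times> (real ^ 'n) \<Rightarrow> real \<times> (real ^ 'n)) \<Rightarrow> 'a set \<Rightarrow>
     (real \<times> 'a \<Rightarrow> real \<times> (real ^ 'n)) \<Rightarrow>
     real \<times> (real ^ 'n) \<Rightarrow> real \<times> (real ^ 'n) \<Rightarrow> ennreal" where
  "dist_zero T v P Z x y = (SUP lam\<in>{0<..1}. dist_lam T v P Z lam x y)"

text \<open>Where the distance is \<open>\<infinity>\<close> and \<open>L > 0\<close>, the inequality is void.\<close>

definition directionally_lipschitz_on ::
    "real \<Rightarrow> (real \<times> (real ^ 'n) \<Rightarrow> real \<times> (real ^ 'n)) \<Rightarrow> 'a set \<Rightarrow>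
     (real \<times> 'a \<Rightarrow> real \<times> (real ^ 'n)) \<Rightarrow> real \<Rightarrow>
     (real \<times> (real ^ 'n)) set \<Rightarrow> (real \<times> (real ^ 'n) \<Rightarrow> real) \<Rightarrow> bool" where
  "directionally_lipschitz_on T v P Z L D \<phi> \<longleftrightarrow>
     (\<forall>x\<in>D. \<forall>y\<in>D. ennreal \<bar>\<phi> y - \<phi> x\<bar> \<le> ennreal L * dist_zero T v P Z x y)"

end

theory Submission
  imports Defs
begin

text \<open>
  Up to reparametrisation a competitor is a finite chain of jumps at constant time, each of length
  at most \<open>\<parallel>v\<parallel>\<^sub>\<infinity>\<close> times its cost, and of moves along single flow curves, so \<open>d\<^sub>\<lambda>\<close> is an infimum over such
  chains; density of the image of \<open>Z\<close> makes it Lipschitz for the Euclidean distance, with a constant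
  depending on \<open>\<lambda>\<close>. It then suffices to show that \<open>\<phi>\<close> is \<open>(L + \<epsilon>)\<close>-Lipschitz for one \<open>d\<^sub>\<lambda>\<close> on the
  flow-tube: the McShane extension with respect to this \<open>d\<^sub>\<lambda>\<close> has both required properties, because
  \<open>d\<^sub>\<lambda> \<le> d\<^sub>0\<close>.

  For a short chain from \<open>x\<close> to \<open>y\<close>, follow the curve of the tube through \<open>x\<close> up to the time of \<open>y\<close>. By
  uniform continuity of \<open>v\<close> in space, the parallel moves of the chain stay almost parallel to that curve, so it
  ends at a distance from \<open>y\<close> that is small compared with the cost of the chain; combine the
  directional estimate along the curve with the Euclidean one for the remaining gap. Pairs at
  distance at least \<open>\<delta>\<close> are handled by compactness of the tube, letting \<open>\<lambda>\<close> tend to \<open>0\<close>.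
\<close>

subsection \<open>Lipschitz curves with a derivative almost everywhere\<close>

text \<open>
  Cover the exceptional null set by an open set \<open>U\<close> of small measure; \<open>C\<close> times the measure of \<open>U\<close>
  pays for the increments of \<open>f\<close> there, and the two local estimates are glued by bisection.
\<close>

lemma lipschitz_AE_derivative_bound:
  fixes f :: "real \<Rightarrow> 'b::real_normed_vector"
  assumes "a \<le> b" "0 \<le> B" and lip: "C-lipschitz_on {a..b} f"
    and der: "AE s in lborel. s \<in> {a<..<b} \<longrightarrow> (\<exists>d. (f has_vector_derivative d) (at s) \<and> norm d \<le> B)"
  shows "norm (f b - f a) \<le> B * (b - a)"
proof -
  \<comment> \<open>The endpoints join the exceptional set because the derivative is controlled only
    inside the open interval; the Lipschitz bound pays for them as well.\<close>
  define N where "N = insert a (insert b {s\<in>{a<..<b}. \<not> (\<exists>d. (f has_vector_derivative d) (at s) \<and> norm d \<le> B)})"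
  obtain N0 where N0: "{s \<in> space lborel. \<not> (s \<in> {a<..<b} \<longrightarrow> (\<exists>d. (f has_vector_derivative d) (at s) \<and> norm d \<le> B))} \<subseteq> N0"
    "emeasure lborel N0 = 0" "N0 \<in> sets lborel"
    by (rule AE_E[OF der]) blast
  have "negligible N0"
    using N0(2,3) by (simp add: negligible_iff_null_sets null_sets_completionI null_setsI)
  moreover have "N \<subseteq> insert a (insert b N0)"
    using N0(1) by (auto simp: N_def)
  ultimately have N: "negligible N"
    by (meson negligible_insert negligible_subset)
  have C: "C \<ge> 0" using lip by (rule lipschitz_on_nonneg)
  have "norm (f b - f a) \<le> B * (b - a) + e" if "e > 0" for e
  proof -
    \<comment> \<open>\<open>e1\<close> is the excess slope allowed at regular points,
      \<open>e2\<close> the measure allowed for the cover; each contributes at most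
      \<open>e / 2\<close>. The added \<open>1\<close> keeps the denominators positive when
      \<open>a = b\<close> or \<open>C = 0\<close>.\<close>
    define e1 where "e1 = e / (2 * (b - a + 1))"
    define e2 where "e2 = e / (2 * (C + 1))"
    have e12: "e1 > 0" "e2 > 0" using that assms C by (auto simp: e1_def e2_def)
    obtain U where U: "open U" "N \<subseteq> U" "(U - N) \<in> lmeasurable" "emeasure lebesgue (U - N) < ennreal e2"
      using sets_lebesgue_outer_open[OF negligible_imp_sets[OF N] e12(2)] by blast
    have "U \<in> lmeasurable"
    proof -
      have "U = (U - N) \<union> N" using U(2) by auto
      then show ?thesis
        using fmeasurable.Un[of "U - N" lebesgue N] U(3) N by (simp add: negligible_iff_measure)
    qed
    have "measure lebesgue U \<le> e2"
    proof -
      have "measure lebesgue U = measure lebesgue (U - N)"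
        using N fmeasurableD[OF \<open>U \<in> lmeasurable\<close>] measure_Diff_null_set[symmetric]
        unfolding negligible_iff_null_sets by blast
      then show ?thesis
        using U(4) unfolding emeasure_eq_measure2[OF U(3)] by (simp add: ennreal_less_iff)
    qed
    \<comment> \<open>Adjacent half-open intervals are disjoint, which gives the additivity of
      \<open>m\<close> on which the bisection rests.\<close>
    define m where "m c d = measure lebesgue (U \<inter> {c<..d})" for c d
    have m_add: "m c d + m d e = m c e" if "c \<le> d" "d \<le> e" for c d e
    proof -
      have "U \<inter> {c<..e} = (U \<inter> {c<..d}) \<union> (U \<inter> {d<..e})" using that by auto
      moreover have "(U \<inter> {c<..d}) \<in> lmeasurable" "(U \<inter> {d<..e}) \<in> lmeasurable"
        using \<open>U \<in> lmeasurable\<close> by (auto intro!: fmeasurable_Int_fmeasurable)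
      moreover have "measure lebesgue ((U \<inter> {c<..d}) \<union> (U \<inter> {d<..e}))
          = measure lebesgue (U \<inter> {c<..d}) + measure lebesgue (U \<inter> {d<..e})"
        by (rule measure_Un_AE) (use calculation in auto)
      ultimately show ?thesis by (simp add: m_def)
    qed
    have m_nonneg: "m c d \<ge> 0" for c d by (simp add: m_def)
    \<comment> \<open>The guard makes \<open>R\<close> vacuous on intervals that leave
      \<open>[a,b]\<close>: the bisection tests all short intervals around a point, even around an
      endpoint.\<close>
    define R where "R c d \<longleftrightarrow> (a \<le> c \<and> c \<le> d \<and> d \<le> b \<longrightarrow> norm (f d - f c) \<le> (B + e1) * (d - c) + C * m c d)" for c d
    have "R a b" using \<open>a \<le> b\<close>
    proof (induction rule: Bolzano)
      case (trans c d e)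
      show ?case unfolding R_def
      proof (intro impI)
        assume "a \<le> c \<and> c \<le> e \<and> e \<le> b"
        then have "norm (f d - f c) \<le> (B + e1) * (d - c) + C * m c d" "norm (f e - f d) \<le> (B + e1) * (e - d) + C * m d e"
          using trans by (auto simp: R_def)
        moreover have "norm (f e - f c) \<le> norm (f d - f c) + norm (f e - f d)"
          using norm_triangle_ineq[of "f d - f c" "f e - f d"] by simp
        ultimately have "norm (f e - f c) \<le> (B + e1) * (e - c) + C * (m c d + m d e)"
          by (simp add: algebra_simps)
        then show "norm (f e - f c) \<le> (B + e1) * (e - c) + C * m c e"
          using m_add trans by simp
      qed
    next
      case (local x)
      show ?case
      proof (cases "x \<in> N")
        case True
        then obtain r where r: "r > 0" "cball x r \<subseteq> U"
          using U(1,2) open_contains_cball by blast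
        have "R c d" if "c \<le> x" "x \<le> d" "d - c < r" for c d
          unfolding R_def
        proof (intro impI)
          assume cd: "a \<le> c \<and> c \<le> d \<and> d \<le> b"
          \<comment> \<open>So close to an exceptional point the whole interval lies in
            \<open>U\<close>. Its length then equals \<open>m c d\<close>, and
            \<open>C * m c d\<close> alone pays for the Lipschitz increment.\<close>
          have "{c<..d} \<subseteq> cball x r" using that by (auto simp: dist_real_def)
          then have "U \<inter> {c<..d} = {c<..d}" using r by auto
          then have "m c d = d - c" using cd by (simp add: m_def)
          moreover have "norm (f d - f c) \<le> C * (d - c)"
            using lipschitz_onD[OF lip, of d c] cd by (simp add: dist_norm)
          ultimately show "norm (f d - f c) \<le> (B + e1) * (d - c) + C * m c d"
            using assms e12 cd by (simp add: add_increasing)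
        qed
        then show ?thesis using r by blast
      next
        case False
        then obtain D where D: "(f has_vector_derivative D) (at x)" "norm D \<le> B"
          using local by (auto simp: N_def)
        obtain r where r: "r > 0" "\<And>y. norm (y - x) < r \<Longrightarrow> norm (f y - f x - (y - x) *\<^sub>R D) \<le> e1 * norm (y - x)"
          using D(1) e12 unfolding has_vector_derivative_def has_derivative_at_alt by blast
        have *: "norm (f y - f x) \<le> (B + e1) * norm (y - x)" if "norm (y - x) < r" for y
        proof -
          have "norm (f y - f x) \<le> norm (f y - f x - (y - x) *\<^sub>R D) + norm ((y - x) *\<^sub>R D)"
            by (metis diff_add_cancel norm_triangle_ineq)
          also have "\<dots> \<le> e1 * norm (y - x) + norm (y - x) * B"
            using r(2)[OF that] D(2) by (auto intro!: add_mono mult_left_mono)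
          finally show ?thesis by (simp add: algebra_simps)
        qed
        \<comment> \<open>The increment is split at \<open>x\<close>; since \<open>x\<close> lies
          between \<open>c\<close> and \<open>d\<close>, the two distances add up to
          \<open>d - c\<close> and no constant is lost.\<close>
        have "R c d" if "c \<le> x" "x \<le> d" "d - c < r" for c d
          unfolding R_def
        proof (intro impI)
          assume cd: "a \<le> c \<and> c \<le> d \<and> d \<le> b"
          have "norm (f d - f c) \<le> norm (f d - f x) + norm (f c - f x)"
            by (metis norm_minus_commute norm_diff_triangle_le order_refl)
          also have "\<dots> \<le> (B + e1) * (d - x) + (B + e1) * (x - c)"
            using *[of d] *[of c] that by auto
          finally have "norm (f d - f c) \<le> (B + e1) * (d - c)" by (simp add: algebra_simps)
          then show "norm (f d - f c) \<le> (B + e1) * (d - c) + C * m c d"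
            using C m_nonneg[of c d] by (simp add: add_increasing2)
        qed
        then show ?thesis using r by blast
      qed
    qed
    then have "norm (f b - f a) \<le> (B + e1) * (b - a) + C * m a b"
      using \<open>a \<le> b\<close> by (simp add: R_def)
    also have "C * m a b \<le> C * e2"
    proof -
      have "m a b \<le> measure lebesgue U" unfolding m_def
        by (rule measure_mono_fmeasurable) (use \<open>U \<in> lmeasurable\<close> in auto)
      then show ?thesis using C \<open>measure lebesgue U \<le> e2\<close> by (simp add: mult_left_mono)
    qed
    also have "C * e2 \<le> e / 2" using C that by (simp add: e2_def field_simps)
    also have "(B + e1) * (b - a) \<le> B * (b - a) + e / 2"
      using \<open>a \<le> b\<close> that by (simp add: e1_def field_simps)
    finally show ?thesis by simp
  qed
  then show ?thesis by (rule field_le_epsilon)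
qed

subsection \<open>Smooth step functions\<close>

text \<open>The functions \<open>p(1/x) exp(-1/x)\<close>, extended by \<open>0\<close> to \<open>x \<le> 0\<close>, form a class closed under differentiation.\<close>

definition flat_exp :: "real poly \<Rightarrow> real \<Rightarrow> real" where
  "flat_exp p x = (if x \<le> 0 then 0 else poly p (1 / x) * exp (- (1 / x)))"

lemma poly_div_exp_tendsto_0: "((\<lambda>x. poly p x / exp x) \<longlongrightarrow> (0::real)) at_top"
proof -
  have "((\<lambda>x. \<Sum>i\<le>degree p. coeff p i * (x ^ i / exp x)) \<longlongrightarrow> (\<Sum>i\<le>degree p. coeff p i * 0)) at_top"
    by (intro tendsto_intros tendsto_power_div_exp_0)
  then show ?thesis by (simp add: poly_altdef sum_divide_distrib)
qed

text \<open>With \<open>y = 1 / x\<close>, the inner derivative of \<open>p(y) exp(-y)\<close>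
  contributes \<open>-y^2\<close> and the product rule \<open>p' - p\<close>, hence the polynomial
  \<open>y^2 (p - p')\<close>. At the origin the right difference quotient is
  \<open>y p(y) / exp y\<close>, which tends to \<open>0\<close> because the exponential beats every
  polynomial.\<close>

lemma flat_exp_has_derivative:
  "(flat_exp p has_real_derivative flat_exp ([:0, 0, 1:] * (p - pderiv p)) x) (at x)"
proof -
  consider "x < 0" | "x = 0" | "x > 0" by linarith
  then show ?thesis
  proof cases
    case 1
    have "((\<lambda>_. 0) has_real_derivative 0) (at x)" by simp
    then have "(flat_exp p has_real_derivative 0) (at x)"
      by (rule has_field_derivative_transform_within_open[where S="{..<0}"]) (use 1 in \<open>auto simp: flat_exp_def\<close>)
    then show ?thesis using 1 by (simp add: flat_exp_def)
  next
    case 2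
    have "((\<lambda>h. poly (pCons 0 p) (1 / h) / exp (1 / h)) \<longlongrightarrow> 0) (at_right 0)"
      by (rule filterlim_compose[OF poly_div_exp_tendsto_0])
        (simp add: divide_inverse filterlim_inverse_at_top_right)
    then have "((\<lambda>h. flat_exp p h / h) \<longlongrightarrow> 0) (at_right 0)"
      by (rule Lim_transform_eventually)
        (auto simp: flat_exp_def eventually_at_right_field exp_minus field_simps intro!: exI[of _ 1])
    moreover have "((\<lambda>h. flat_exp p h / h) \<longlongrightarrow> 0) (at_left 0)"
      by (rule Lim_transform_eventually[OF tendsto_const])
        (auto simp: flat_exp_def eventually_at_left_field intro!: exI[of _ "-1"])
    ultimately have "((\<lambda>h. flat_exp p h / h) \<longlongrightarrow> 0) (at 0)"
      by (simp add: filterlim_at_split)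
    then show ?thesis using 2 by (simp add: DERIV_def flat_exp_def)
  next
    case 3
    have "((\<lambda>x. poly p (1 / x) * exp (- (1 / x))) has_real_derivative
        flat_exp ([:0, 0, 1:] * (p - pderiv p)) x) (at x)"
      using 3 by (auto intro!: derivative_eq_intros DERIV_chain2[of "poly p", OF poly_DERIV]
          simp: flat_exp_def field_simps power2_eq_square)
    then show ?thesis
      by (rule has_field_derivative_transform_within_open[where S="{0<..}"]) (use 3 in \<open>auto simp: flat_exp_def\<close>)
  qed
qed

text \<open>
  Every member has a derivative that is again a member, which yields derivatives of all orders
  without computing them.
\<close>

inductive_set smooth_fns :: "(real \<Rightarrow> real) set" where
  flat_exp: "flat_exp p \<in> smooth_fns"
| const: "(\<lambda>_. c) \<in> smooth_fns"
| add: "f \<in> smooth_fns \<Longrightarrow> g \<in> smooth_fns \<Longrightarrow> (\<lambda>x. f x + g x) \<in> smooth_fns"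
| mult: "f \<in> smooth_fns \<Longrightarrow> g \<in> smooth_fns \<Longrightarrow> (\<lambda>x. f x * g x) \<in> smooth_fns"
| inverse: "f \<in> smooth_fns \<Longrightarrow> (\<And>x. f x \<noteq> 0) \<Longrightarrow> (\<lambda>x. inverse (f x)) \<in> smooth_fns"
| affine: "f \<in> smooth_fns \<Longrightarrow> (\<lambda>x. f (a * x + b)) \<in> smooth_fns"

lemma smooth_fns_derivative:
  "f \<in> smooth_fns \<Longrightarrow> \<exists>f'\<in>smooth_fns. \<forall>x. (f has_real_derivative f' x) (at x)"
proof (induction rule: smooth_fns.induct)
  case (flat_exp p)
  then show ?case using flat_exp_has_derivative smooth_fns.flat_exp by blast
next
  case (const c)
  then show ?case by (intro bexI[of _ "\<lambda>_. 0"]) (auto intro: smooth_fns.const)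
next
  case (add f g)
  then obtain f' g' where "f' \<in> smooth_fns" "\<forall>x. (f has_real_derivative f' x) (at x)"
    "g' \<in> smooth_fns" "\<forall>x. (g has_real_derivative g' x) (at x)" by blast
  then show ?case
    by (intro bexI[of _ "\<lambda>x. f' x + g' x"]) (auto intro!: smooth_fns.add derivative_intros)
next
  case (mult f g)
  then obtain f' g' where "f' \<in> smooth_fns" "\<forall>x. (f has_real_derivative f' x) (at x)"
    "g' \<in> smooth_fns" "\<forall>x. (g has_real_derivative g' x) (at x)" by blast
  then show ?case using mult
    by (intro bexI[of _ "\<lambda>x. f' x * g x + g' x * f x"]) (auto intro!: smooth_fns.intros DERIV_mult)
next
  case (inverse f)
  then obtain f' where f': "f' \<in> smooth_fns" "\<forall>x. (f has_real_derivative f' x) (at x)" by blast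
  have "(\<lambda>x. (-1) * (inverse (f x) * f' x * inverse (f x))) \<in> smooth_fns"
    using inverse f' by (intro smooth_fns.mult smooth_fns.const smooth_fns.inverse) auto
  then show ?case
    by (rule rev_bexI) (use f' inverse in \<open>auto intro!: derivative_eq_intros\<close>)
next
  case (affine f a b)
  then obtain f' where f': "f' \<in> smooth_fns" "\<forall>x. (f has_real_derivative f' x) (at x)" by blast
  have "((\<lambda>x. f (a * x + b)) has_real_derivative a * f' (a * x + b)) (at x)" for x
  proof -
    have "((\<lambda>x. a * x + b) has_real_derivative a) (at x)"
      by (auto intro!: derivative_eq_intros)
    then show ?thesis
      using DERIV_chain2[of f "f' (a * x + b)" "\<lambda>x. a * x + b"] f'(2) by (simp add: mult.commute)
  qed
  moreover have "(\<lambda>x. a * f' (a * x + b)) \<in> smooth_fns"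
    using f' by (intro smooth_fns.mult smooth_fns.const smooth_fns.affine)
  ultimately show ?case by (intro bexI[of _ "\<lambda>x. a * f' (a * x + b)"] allI)
qed

section \<open>Iterated derivatives and test functions\<close>

lemma smooth_fns_deriv: "f \<in> smooth_fns \<Longrightarrow> deriv f \<in> smooth_fns"
  by (metis DERIV_imp_deriv ext smooth_fns_derivative)

lemma smooth_fns_DERIV: "f \<in> smooth_fns \<Longrightarrow> (f has_real_derivative deriv f x) (at x)"
  by (metis DERIV_imp_deriv smooth_fns_derivative)

lemma smooth_fns_continuous_on: "f \<in> smooth_fns \<Longrightarrow> continuous_on S f"
  by (meson DERIV_isCont continuous_at_imp_continuous_on smooth_fns_DERIV)

lemma smooth_fns_funpow_deriv: "f \<in> smooth_fns \<Longrightarrow> (deriv ^^ k) f \<in> smooth_fns"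
  by (induction k) (auto intro: smooth_fns_deriv)

lemma smooth_fns_imp_test_function:
  assumes "f \<in> smooth_fns" "a < c" "d < b" "\<And>t. t \<notin> {c..d} \<Longrightarrow> f t = 0"
  shows "test_function a b f"
proof -
  have "closure {t. f t \<noteq> 0} \<subseteq> {c..d}"
    using assms(4) by (intro closure_minimal) (auto, (metis atLeastAtMost_iff)+)
  then have "compact (closure {t. f t \<noteq> 0})" "closure {t. f t \<noteq> 0} \<subseteq> {a<..<b}"
    using assms(2,3) bounded_subset[of "{c..d}"] by (auto simp: compact_eq_bounded_closed)
  moreover have "((deriv ^^ k) f) differentiable (at t)" for k t
    using smooth_fns_DERIV[OF smooth_fns_funpow_deriv[OF assms(1)]] real_differentiable_def by blast
  ultimately show ?thesis by (simp add: test_function_def)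
qed

text \<open>The standard smooth transition from \<open>0\<close> to \<open>1\<close> across
  \<open>[0,1]\<close>. The denominator never vanishes, since \<open>x\<close> or
  \<open>1 - x\<close> is positive.\<close>

definition smooth_step :: "real \<Rightarrow> real" where
  "smooth_step x = flat_exp 1 x * inverse (flat_exp 1 x + flat_exp 1 (1 - x))"

lemma flat_exp_1_nonneg: "flat_exp 1 x \<ge> 0"
  by (simp add: flat_exp_def)

lemma smooth_step_denominator_pos: "flat_exp 1 x + flat_exp 1 (1 - x) > 0"
  by (auto simp: flat_exp_def add_pos_pos)

lemma smooth_step_in_smooth_fns: "smooth_step \<in> smooth_fns"
proof -
  have "(\<lambda>x. flat_exp 1 (1 - x)) = (\<lambda>x. flat_exp 1 ((-1) * x + 1))" by (simp add: algebra_simps)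
  then have "(\<lambda>x. flat_exp 1 (1 - x)) \<in> smooth_fns"
    using smooth_fns.affine[OF smooth_fns.flat_exp, of 1 "-1" 1] by simp
  then have "(\<lambda>x. flat_exp 1 x * inverse (flat_exp 1 x + flat_exp 1 (1 - x))) \<in> smooth_fns"
    by (intro smooth_fns.mult smooth_fns.inverse smooth_fns.add smooth_fns.flat_exp)
      (auto simp: smooth_step_denominator_pos less_imp_neq[symmetric])
  then show ?thesis by (simp add: smooth_step_def[abs_def])
qed

lemma smooth_step_eq_0: "x \<le> 0 \<Longrightarrow> smooth_step x = 0"
  by (simp add: smooth_step_def flat_exp_def)

lemma smooth_step_eq_1: "x \<ge> 1 \<Longrightarrow> smooth_step x = 1"
  by (simp add: smooth_step_def flat_exp_def)

text \<open>Clearing denominators cancels the common product and leaves a comparison of the two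
  cross products, which follows from the monotonicity of \<open>flat_exp 1\<close>.\<close>

lemma smooth_step_mono: "x \<le> y \<Longrightarrow> smooth_step x \<le> smooth_step y"
proof -
  have mono: "flat_exp 1 x \<le> flat_exp 1 y" if "x \<le> y" for x y :: real
    using that by (auto simp: flat_exp_def field_simps)
  assume "x \<le> y"
  have eq: "smooth_step x = flat_exp 1 x / (flat_exp 1 x + flat_exp 1 (1 - x))" for x
    by (simp add: smooth_step_def divide_inverse)
  have "flat_exp 1 x * flat_exp 1 (1 - y) \<le> flat_exp 1 y * flat_exp 1 (1 - x)"
    using \<open>x \<le> y\<close> mono flat_exp_1_nonneg by (intro mult_mono) auto
  then show ?thesis
    using smooth_step_denominator_pos[of x] smooth_step_denominator_pos[of y]
    by (simp add: eq divide_le_eq le_divide_eq frac_le_eq divide_simps algebra_simps)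
qed

lemma smooth_step_bounds: "0 \<le> smooth_step x" "smooth_step x \<le> 1"
  using smooth_step_mono[of "min x 0" x] smooth_step_mono[of x "max x 1"]
  by (auto simp: smooth_step_eq_0 smooth_step_eq_1)

lemma deriv_smooth_step_nonneg: "deriv smooth_step x \<ge> 0"
  using smooth_fns_DERIV[OF smooth_step_in_smooth_fns]
  by (intro mono_on_imp_deriv_nonneg[of UNIV smooth_step]) (auto simp: mono_on_def smooth_step_mono)

subsection \<open>Increments and distributional derivatives\<close>

text \<open>The rescaled derivative of the step is a continuous probability density on
  \<open>[c, c + e]\<close>: an averaging kernel that is itself the derivative of a smooth function,
  so that it can arise from a test function.\<close>

lemma smooth_step_weight:
  fixes c e :: real
  assumes "e > 0"
  defines "w \<equiv> \<lambda>t. deriv smooth_step ((t - c) / e) / e"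
  shows smooth_step_weight_nonneg: "w t \<ge> 0"
    and smooth_step_weight_continuous: "continuous_on S w"
    and smooth_step_weight_outside: "t \<notin> {c..c + e} \<Longrightarrow> w t = 0"
    and smooth_step_weight_integral: "(LINT t|lborel. indicator {c..c + e} t * w t) = 1"
    and smooth_step_weight_DERIV: "((\<lambda>t. smooth_step ((t - c) / e)) has_real_derivative w t) (at t)"
proof -
  show D: "((\<lambda>t. smooth_step ((t - c) / e)) has_real_derivative w t) (at t)" for t
  proof -
    have "((\<lambda>t. (t - c) / e) has_real_derivative 1 / e) (at t)"
      using \<open>e > 0\<close> by (auto intro!: derivative_eq_intros)
    from DERIV_chain2[OF smooth_fns_DERIV[OF smooth_step_in_smooth_fns] this]
    show ?thesis by (simp add: w_def)
  qed
  show "w t \<ge> 0" for t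
    using \<open>e > 0\<close> deriv_smooth_step_nonneg by (simp add: w_def)
  have "continuous_on UNIV (deriv smooth_step)"
    by (intro smooth_fns_continuous_on smooth_fns_deriv smooth_step_in_smooth_fns)
  then have "continuous_on S (\<lambda>t. deriv smooth_step ((t - c) / e))" for S
    by (rule continuous_on_compose2) (use \<open>e > 0\<close> in \<open>auto intro!: continuous_intros\<close>)
  then show cont: "continuous_on S w" for S
    unfolding w_def using \<open>e > 0\<close> by (intro continuous_on_divide continuous_on_const) auto
  show "w t = 0" if "t \<notin> {c..c + e}" for t
  proof -
    consider "t < c" | "t > c + e" using \<open>t \<notin> {c..c + e}\<close> by fastforce
    then have "((\<lambda>t. smooth_step ((t - c) / e)) has_real_derivative 0) (at t)"
    proof cases
      case 1
      show ?thesis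
        by (rule has_field_derivative_transform_within_open[where S="{..<c}" and f="\<lambda>_. 0"])
          (use 1 \<open>e > 0\<close> in \<open>auto simp: smooth_step_eq_0 divide_le_eq\<close>)
    next
      case 2
      show ?thesis
        by (rule has_field_derivative_transform_within_open[where S="{c + e<..}" and f="\<lambda>_. 1"])
          (use 2 \<open>e > 0\<close> in \<open>auto simp: smooth_step_eq_1 le_divide_eq\<close>)
    qed
    then show ?thesis using D DERIV_unique by blast
  qed
  have "(LINT t|lborel. w t * indicator {c..c + e} t)
      = smooth_step ((c + e - c) / e) - smooth_step ((c - c) / e)"
  proof (rule integral_FTC_Icc_real)
    show "isCont w x" for x
      using cont[of UNIV] continuous_on_eq_continuous_at[OF open_UNIV] by blast
  qed (use \<open>e > 0\<close> D in simp_all)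
  moreover have "smooth_step ((c + e - c) / e) - smooth_step ((c - c) / e) = 1"
    using \<open>e > 0\<close> by (simp add: smooth_step_eq_0 smooth_step_eq_1)
  ultimately show "(LINT t|lborel. indicator {c..c + e} t * w t) = 1"
    by (simp add: mult.commute)
qed

lemma integrable_continuous_weight:
  fixes f :: "real \<Rightarrow> 'b::euclidean_space"
  assumes "continuous_on {c..d} w" "continuous_on {c..d} f"
  shows "integrable lborel (\<lambda>t. (indicator {c..d} t * w t) *\<^sub>R f t)"
  using borel_integrable_compact[of "{c..d}" "\<lambda>t. w t *\<^sub>R f t"] assms
  by (auto intro!: continuous_intros)

text \<open>The weight has mass one and sits within distance \<open>e\<close> of \<open>c\<close>,
  so subtracting the constant \<open>f c\<close> under the integral leaves only an oscillation of
  size \<open>K * e\<close>.\<close>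

lemma weighted_average_lipschitz:
  fixes f :: "real \<Rightarrow> 'b::euclidean_space"
  assumes lip: "K-lipschitz_on {c..c + e} f" and "e > 0"
    and w: "\<And>t. w t \<ge> 0" "continuous_on UNIV w" "(LINT t|lborel. indicator {c..c + e} t * w t) = 1"
  shows "norm ((LINT t|lborel. (indicator {c..c + e} t * w t) *\<^sub>R f t) - f c) \<le> K * e"
proof -
  let ?W = "\<lambda>t. indicator {c..c + e} t * w t"
  have wc: "continuous_on {c..c + e} w" using w(2) continuous_on_subset by blast
  have fc: "continuous_on {c..c + e} f" using lip by (rule lipschitz_on_continuous_on)
  have intW: "integrable lborel ?W"
    using integrable_continuous_weight[OF wc, of "\<lambda>_. 1 :: real"] by simp
  have "(LINT t|lborel. ?W t *\<^sub>R f t) - f c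
      = (LINT t|lborel. ?W t *\<^sub>R f t) - (LINT t|lborel. ?W t *\<^sub>R f c)"
    by (simp add: intW w(3))
  moreover have "\<dots> = (LINT t|lborel. ?W t *\<^sub>R f t - ?W t *\<^sub>R f c)"
    by (rule Bochner_Integration.integral_diff[symmetric])
      (auto intro!: integrable_continuous_weight wc fc continuous_intros)
  ultimately have "norm ((LINT t|lborel. ?W t *\<^sub>R f t) - f c)
      \<le> (LINT t|lborel. norm (?W t *\<^sub>R f t - ?W t *\<^sub>R f c))"
    using integral_norm_bound[of lborel "\<lambda>t. ?W t *\<^sub>R f t - ?W t *\<^sub>R f c"] by (simp only:)
  also have "\<dots> \<le> (LINT t|lborel. ?W t * (K * e))"
  proof (rule integral_mono')
    show "integrable lborel (\<lambda>t. ?W t * (K * e))" using intW by (rule integrable_mult_left)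
    fix t
    have "K \<ge> 0" using lip by (rule lipschitz_on_nonneg)
    show "0 \<le> ?W t * (K * e)" using w(1) \<open>K \<ge> 0\<close> \<open>e > 0\<close>
      by (intro mult_nonneg_nonneg) auto
    show "norm (?W t *\<^sub>R f t - ?W t *\<^sub>R f c) \<le> ?W t * (K * e)"
    proof (cases "t \<in> {c..c + e}")
      case True
      have "norm (f t - f c) \<le> K * (t - c)"
        using lipschitz_onD[OF lip, of t c] True \<open>e > 0\<close> by (simp add: dist_norm)
      also have "\<dots> \<le> K * e" using True \<open>K \<ge> 0\<close> by (intro mult_left_mono) auto
      finally have "w t * norm (f t - f c) \<le> w t * (K * e)"
        using w(1) by (rule mult_left_mono)
      then show ?thesis
        unfolding scaleR_diff_right[symmetric] using True w(1) by simp
    qed simp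
  qed
  also have "\<dots> = K * e" using w(3) by (simp add: intW)
  finally show ?thesis .
qed

text \<open>
  The test function rises from \<open>0\<close> to \<open>1\<close> on \<open>[c, c + e]\<close> and falls back on \<open>[d, d + e]\<close>, so that its
  derivative turns \<open>f\<close> into the difference of two averages close to \<open>f c\<close> and \<open>f d\<close>.
\<close>

lemma distributional_derivative_increment_le:
  fixes f1 f2 g1 g2 :: "real \<Rightarrow> 'b::euclidean_space"
  assumes D1: "has_distributional_derivative a b f1 g1" and D2: "has_distributional_derivative a b f2 g2"
    and lip1: "K1-lipschitz_on {a..b} f1" and lip2: "K2-lipschitz_on {a..b} f2"
    and s: "a \<le> s" "s \<le> s'" "s' \<le> b" and "0 \<le> B"
    and bound: "AE t in lborel. t \<in> {s<..<s'} \<longrightarrow> norm (g1 t - g2 t) \<le> B"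
  shows "norm ((f1 s' - f2 s') - (f1 s - f2 s)) \<le> B * (s' - s)"
proof (cases "s = s'")
  case False
  define f where "f = (\<lambda>t. f1 t - f2 t)"
  define K where "K = K1 + K2"
  have lip: "K-lipschitz_on {a..b} f"
    unfolding f_def K_def using lip1 lip2 by (rule lipschitz_on_diff)
  then have "K \<ge> 0" by (rule lipschitz_on_nonneg)
  have "norm (f s' - f s) \<le> B * (s' - s) + \<epsilon>" if "\<epsilon> > 0" for \<epsilon>
  proof -
    \<comment> \<open>The first bound leaves room for a rise and a fall of width \<open>e\<close>
      that do not overlap. The second makes the errors collected at the end, five times
      \<open>K * e\<close> in all, at most \<open>\<epsilon>\<close>.\<close>
    define e where "e = min ((s' - s) / 4) (\<epsilon> / (5 * (K + 1)))"
    have "e > 0"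
      using s False that \<open>K \<ge> 0\<close> by (simp add: e_def)
    have "e \<le> (s' - s) / 4" unfolding e_def by (rule min.cobounded1)
    then have "4 * e \<le> s' - s" by (simp add: le_divide_eq mult.commute)
    have "e \<le> \<epsilon> / (5 * (K + 1))" unfolding e_def by (rule min.cobounded2)
    note e = \<open>e > 0\<close> \<open>4 * e \<le> s' - s\<close> this
    have "5 * (K * e) \<le> 5 * ((K + 1) * e)" using e(1) by simp
    also have "\<dots> \<le> \<epsilon>" using e(3) \<open>K \<ge> 0\<close> by (simp add: field_simps)
    finally have Ke: "5 * (K * e) \<le> \<epsilon>" .
    \<comment> \<open>A margin \<open>e\<close> on either side keeps the support
      \<open>[c, d + e]\<close> of the test function inside the open interval even when
      \<open>s = a\<close> or \<open>s' = b\<close>.\<close>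
    define c where "c = s + e"
    define d where "d = s' - 2 * e"
    have cd: "s < c" "c < d" "d + e < s'" using e(1,2) by (auto simp: c_def d_def)
    define w where "w c t = deriv smooth_step ((t - c) / e) / e" for c t
    note w = smooth_step_weight_nonneg[OF e(1), folded w_def]
      smooth_step_weight_continuous[OF e(1), folded w_def]
      smooth_step_weight_outside[OF e(1), folded w_def]
      smooth_step_weight_integral[OF e(1), folded w_def]
      smooth_step_weight_DERIV[OF e(1), folded w_def]
    define \<eta> where "\<eta> t = smooth_step ((t - c) / e) - smooth_step ((t - d) / e)" for t
    have "(\<lambda>t. smooth_step ((1 / e) * t + (- c / e)) + (-1) * smooth_step ((1 / e) * t + (- d / e))) \<in> smooth_fns"
      by (intro smooth_fns.add smooth_fns.mult smooth_fns.const
          smooth_fns.affine[OF smooth_step_in_smooth_fns])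
    also have "(\<lambda>t. smooth_step ((1 / e) * t + (- c / e)) + (-1) * smooth_step ((1 / e) * t + (- d / e))) = \<eta>"
      by (auto simp: \<eta>_def diff_divide_distrib)
    finally have \<eta>_smooth: "\<eta> \<in> smooth_fns" .
    have \<eta>_outside: "\<eta> t = 0" if "t \<notin> {c..d + e}" for t
    proof -
      consider "t < c" | "t > d + e" using \<open>t \<notin> {c..d + e}\<close> by fastforce
      then show ?thesis
        using cd e(1) by cases (simp_all add: \<eta>_def smooth_step_eq_0 smooth_step_eq_1 divide_le_eq le_divide_eq)
    qed
    have \<eta>_bounds: "0 \<le> \<eta> t" "\<eta> t \<le> 1" for t
    proof -
      have "smooth_step ((t - d) / e) \<le> smooth_step ((t - c) / e)"
        using cd e(1) by (intro smooth_step_mono) (simp add: divide_right_mono)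
      then show "0 \<le> \<eta> t" by (simp add: \<eta>_def)
      show "\<eta> t \<le> 1"
        unfolding \<eta>_def using smooth_step_bounds(2)[of "(t - c) / e"] smooth_step_bounds(1)[of "(t - d) / e"] by linarith
    qed
    have \<eta>_test: "test_function a b \<eta>"
      using \<eta>_smooth \<eta>_outside cd s by (intro smooth_fns_imp_test_function[of _ _ c "d + e"]) auto
    have \<eta>_deriv: "deriv \<eta> t = w c t - w d t" for t
    proof -
      have "((\<lambda>t. smooth_step ((t - c) / e) - smooth_step ((t - d) / e)) has_real_derivative w c t - w d t) (at t)"
        by (intro DERIV_diff w(5))
      then show ?thesis unfolding \<eta>_def[abs_def] by (rule DERIV_imp_deriv)
    qed
    define Av where "Av c f = (LINT t|lborel. (indicator {c..c + e} t * w c t) *\<^sub>R f t)"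
      for c and f :: "real \<Rightarrow> 'b"
    have int_w: "integrable lborel (\<lambda>t. (indicator {c..c + e} t * w c t) *\<^sub>R h t)"
      if "a \<le> c" "c + e \<le> b" "L-lipschitz_on {a..b} h" for c L and h :: "real \<Rightarrow> 'b"
      by (rule integrable_continuous_weight[OF w(2)])
        (rule continuous_on_subset[OF lipschitz_on_continuous_on[OF that(3)]], use that in auto)
    \<comment> \<open>Each kernel vanishes outside its own interval, so the indicator of
      \<open>(a,b)\<close> can be traded for those of \<open>[c, c + e]\<close> and
      \<open>[d, d + e]\<close>.\<close>
    have lhs: "(LINT t:{a<..<b}|lborel. deriv \<eta> t *\<^sub>R h t) = Av c h - Av d h"
      if "L-lipschitz_on {a..b} h" for h L
    proof -
      have "indicator {a<..<b} t *\<^sub>R deriv \<eta> t *\<^sub>R h t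
          = (indicator {c..c + e} t * w c t) *\<^sub>R h t - (indicator {d..d + e} t * w d t) *\<^sub>R h t" for t
      proof -
        have restrict: "indicator {c..c + e} t * w c t = w c t" "indicator {d..d + e} t * w d t = w d t"
          using w(3)[of t c] w(3)[of t d] by (auto simp: indicator_def)
        have "w c t = 0" "w d t = 0" if "t \<notin> {a<..<b}"
          using w(3)[of t c] w(3)[of t d] that cd s e(1) by auto
        then show ?thesis
          unfolding restrict \<eta>_deriv by (cases "t \<in> {a<..<b}") (auto simp: scaleR_diff_left)
      qed
      then show ?thesis
        unfolding set_lebesgue_integral_def Av_def
        using Bochner_Integration.integral_diff[OF int_w[OF _ _ that, of c] int_w[OF _ _ that, of d]] cd s e(1)
        by (simp only:)
    qed
    \<comment> \<open>Only local integrability of \<open>h\<close> is available; the product is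
      integrable on all of \<open>(a,b)\<close> because \<open>\<eta>\<close> is bounded and lives
      on the compact interval \<open>[c, d + e]\<close>.\<close>
    have int_\<eta>: "set_integrable lborel {a<..<b} (\<lambda>t. \<eta> t *\<^sub>R h t)" if "locally_integrable a b h" for h :: "real \<Rightarrow> 'b"
    proof -
      have "set_integrable lborel {c..d + e} h"
        using that cd s unfolding locally_integrable_def by auto
      then have "integrable lborel (\<lambda>t. \<eta> t *\<^sub>R (indicator {c..d + e} t *\<^sub>R h t))"
        unfolding set_integrable_def
      proof (rule Bochner_Integration.integrable_bound)
        have "\<eta> \<in> borel_measurable lborel"
          using borel_measurable_continuous_onI[OF smooth_fns_continuous_on[OF \<eta>_smooth]] by simp
        then show "(\<lambda>t. \<eta> t *\<^sub>R indicator {c..d + e} t *\<^sub>R h t) \<in> borel_measurable lborel"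
          by (rule borel_measurable_scaleR)
            (rule borel_measurable_integrable[OF \<open>set_integrable lborel {c..d + e} h\<close>[unfolded set_integrable_def]])
        show "AE t in lborel. norm (\<eta> t *\<^sub>R indicator {c..d + e} t *\<^sub>R h t) \<le> norm (indicator {c..d + e} t *\<^sub>R h t)"
          using \<eta>_bounds by (intro AE_I2) (simp add: mult.assoc mult_left_le_one_le)
      qed
      also have "(\<lambda>t. \<eta> t *\<^sub>R (indicator {c..d + e} t *\<^sub>R h t)) = (\<lambda>t. indicator {a<..<b} t *\<^sub>R \<eta> t *\<^sub>R h t)"
        using \<eta>_outside cd s by (auto simp: indicator_def fun_eq_iff)
      finally show ?thesis by (simp add: set_integrable_def)
    qed
    have li: "locally_integrable a b g1" "locally_integrable a b g2"
      using D1 D2 by (auto simp: has_distributional_derivative_def)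
    have "Av d f - Av c f = (LINT t:{a<..<b}|lborel. \<eta> t *\<^sub>R g1 t) - (LINT t:{a<..<b}|lborel. \<eta> t *\<^sub>R g2 t)"
    proof -
      have eqs: "Av c f1 - Av d f1 = - (LINT t:{a<..<b}|lborel. \<eta> t *\<^sub>R g1 t)"
        "Av c f2 - Av d f2 = - (LINT t:{a<..<b}|lborel. \<eta> t *\<^sub>R g2 t)"
        using D1 D2 \<eta>_test lhs[OF lip1] lhs[OF lip2] by (auto simp: has_distributional_derivative_def)
      have "Av u f = Av u f1 - Av u f2" if "a \<le> u" "u + e \<le> b" for u
        unfolding Av_def f_def using int_w[OF that lip1] int_w[OF that lip2] by (simp add: scaleR_diff_right)
      then have "Av c f = Av c f1 - Av c f2" "Av d f = Av d f1 - Av d f2"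
        using cd s e(1) by auto
      then have "Av d f - Av c f = (Av c f2 - Av d f2) - (Av c f1 - Av d f1)"
        by simp
      then show ?thesis unfolding eqs by simp
    qed
    moreover have "\<dots> = (LINT t:{a<..<b}|lborel. \<eta> t *\<^sub>R g1 t - \<eta> t *\<^sub>R g2 t)"
      by (rule set_integral_diff(2)[symmetric]) (intro int_\<eta> li)+
    ultimately have "norm (Av d f - Av c f)
        \<le> (LINT t|lborel. norm (indicator {a<..<b} t *\<^sub>R (\<eta> t *\<^sub>R g1 t - \<eta> t *\<^sub>R g2 t)))"
      using integral_norm_bound[of lborel "\<lambda>t. indicator {a<..<b} t *\<^sub>R (\<eta> t *\<^sub>R g1 t - \<eta> t *\<^sub>R g2 t)"]
      unfolding set_lebesgue_integral_def by (simp only:)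
    also have "\<dots> \<le> (LINT t|lborel. indicator {c..d + e} t * B)"
    proof (rule integral_mono_AE')
      show "integrable lborel (\<lambda>t. indicator {c..d + e} t * B :: real)"
        by (intro integrable_mult_left integrable_real_indicator) (auto simp: emeasure_lborel_Icc_eq)
      show "AE t in lborel. 0 \<le> (indicator {c..d + e} t * B :: real)" using \<open>0 \<le> B\<close> by simp
      show "AE t in lborel. norm (indicator {a<..<b} t *\<^sub>R (\<eta> t *\<^sub>R g1 t - \<eta> t *\<^sub>R g2 t)) \<le> indicator {c..d + e} t * B"
        using bound
      proof eventually_elim
        case (elim t)
        show ?case
        proof (cases "t \<in> {c..d + e}")
          case True
          then have "norm (g1 t - g2 t) \<le> B" using elim cd by auto
          then have "\<eta> t * norm (g1 t - g2 t) \<le> 1 * B"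
            using \<eta>_bounds by (intro mult_mono) auto
          then show ?thesis
            unfolding scaleR_diff_right[symmetric] using True \<eta>_bounds[of t] cd s by simp
        next
          case False
          then show ?thesis using \<eta>_outside by simp
        qed
      qed
    qed
    also have "\<dots> = (d + e - c) * B" using cd e(1) by simp
    finally have avg: "norm (Av d f - Av c f) \<le> B * (d + e - c)" by (simp add: mult.commute)
    have Avf: "norm (Av u f - f u) \<le> K * e" if "a \<le> u" "u + e \<le> b" for u
      unfolding Av_def
      by (rule weighted_average_lipschitz[OF lipschitz_on_subset[OF lip] e(1) w(1,2,4)]) (use that in auto)
    have Lipf: "norm (f x - f y) \<le> K * \<bar>x - y\<bar>" if "x \<in> {a..b}" "y \<in> {a..b}" for x y
      using lipschitz_onD[OF lip that] by (simp add: dist_norm)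
    have "norm (f s' - f s) \<le> norm (f s' - f d) + norm (Av d f - f d) + norm (Av d f - Av c f)
        + norm (Av c f - f c) + norm (f c - f s)"
    proof -
      have "norm (f s' - f s) \<le> norm (f s' - f d) + norm (f d - f s)"
        by (rule norm_diff_triangle_le[OF order_refl order_refl])
      moreover have "norm (f d - f s) \<le> norm (f d - f c) + norm (f c - f s)"
        by (rule norm_diff_triangle_le[OF order_refl order_refl])
      moreover have "norm (f d - f c) \<le> norm (f d - Av d f) + norm (Av d f - f c)"
        by (rule norm_diff_triangle_le[OF order_refl order_refl])
      moreover have "norm (Av d f - f c) \<le> norm (Av d f - Av c f) + norm (Av c f - f c)"
        by (rule norm_diff_triangle_le[OF order_refl order_refl])
      ultimately show ?thesis by (simp add: norm_minus_commute)
    qed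
    moreover have "norm (f s' - f d) \<le> 2 * (K * e)" "norm (f c - f s) \<le> K * e"
      using Lipf[of s' d] Lipf[of c s] s cd e(1) by (auto simp: c_def d_def)
    moreover have "norm (Av d f - f d) \<le> K * e" "norm (Av c f - f c) \<le> K * e"
      using Avf s cd e(1) by auto
    moreover have "B * (d + e - c) \<le> B * (s' - s)"
      using \<open>0 \<le> B\<close> cd by (intro mult_left_mono) auto
    ultimately show ?thesis using Ke avg by linarith
  qed
  then have "norm (f s' - f s) \<le> B * (s' - s)" by (rule field_le_epsilon)
  then show ?thesis unfolding f_def .
next
  case True
  then show ?thesis by simp
qed

subsection \<open>Pieces of competitors\<close>

text \<open>Consecutive closed intervals share endpoints, so the lengths are added over the
  half-open versions, which are disjoint and contained in the closed ones.\<close>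

lemma sum_le_emeasure_UN_intervals:
  fixes t :: "nat \<Rightarrow> real"
  assumes mono: "\<And>i. i \<le> n \<Longrightarrow> t i \<le> t (i + 1)" and J: "J \<subseteq> {..n}"
  shows "ennreal (\<Sum>i\<in>J. t (i + 1) - t i) \<le> emeasure lborel (\<Union>i\<in>J. {t i..t (i + 1)})"
proof -
  have "finite J" using J finite_subset by blast
  have mono': "t (i + 1) \<le> t j" if "i < j" "j \<le> n" for i j
    using that
  proof (induction j)
    case (Suc j)
    then show ?case using mono[of j] by (cases "i = j") auto
  qed simp
  have disj: "disjoint_family_on (\<lambda>i. {t i..<t (i + 1)}) J"
    unfolding disjoint_family_on_def
  proof (intro ballI impI)
    fix i j assume "i \<in> J" "j \<in> J" "i \<noteq> j"
    then have "i < j \<and> j \<le> n \<or> j < i \<and> i \<le> n" using J by auto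
    then have "t (i + 1) \<le> t j \<or> t (j + 1) \<le> t i" using mono' by blast
    then show "{t i..<t (i + 1)} \<inter> {t j..<t (j + 1)} = {}" by auto
  qed
  have "ennreal (\<Sum>i\<in>J. t (i + 1) - t i) = (\<Sum>i\<in>J. ennreal (t (i + 1) - t i))"
    using mono J by (intro sum_ennreal[symmetric]) auto
  also have "\<dots> = (\<Sum>i\<in>J. emeasure lborel {t i..<t (i + 1)})"
    using mono J by (intro sum.cong refl) auto
  also have "\<dots> = emeasure lborel (\<Union>i\<in>J. {t i..<t (i + 1)})"
    by (rule sum_emeasure) (use disj \<open>finite J\<close> in auto)
  also have "\<dots> \<le> emeasure lborel (\<Union>i\<in>J. {t i..t (i + 1)})"
    using \<open>finite J\<close> by (intro emeasure_mono UN_mono) (auto intro!: sets.finite_UN)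
  finally show ?thesis .
qed

lemma transversal_piece_increment:
  assumes "transversal_piece T v \<gamma> a b" "C-lipschitz_on {a..b} \<gamma>" "a \<le> b" "0 \<le> sup_norm T v"
  shows "fst (\<gamma> b) = fst (\<gamma> a)" "norm (\<gamma> b - \<gamma> a) \<le> sup_norm T v * (b - a)"
proof -
  show "fst (\<gamma> b) = fst (\<gamma> a)"
    using assms(1,3) unfolding transversal_piece_def by (meson atLeastAtMost_iff order_refl)
  have "AE s in lborel. s \<in> {a<..<b} \<longrightarrow>
      (\<exists>d. (\<gamma> has_vector_derivative d) (at s) \<and> norm d \<le> sup_norm T v)"
    using assms(1) unfolding transversal_piece_def by blast
  then show "norm (\<gamma> b - \<gamma> a) \<le> sup_norm T v * (b - a)"
    by (rule lipschitz_AE_derivative_bound[OF assms(3,4,2)])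
qed

text \<open>Subtracting \<open>\<sigma> * r\<close> from the time coordinate leaves a Lipschitz
  function with derivative zero almost everywhere, which therefore has no increment.\<close>

lemma flow_piece_increment:
  assumes fp: "flow_piece P Z \<sigma> \<gamma> a b" and lip: "C-lipschitz_on {a..b} \<gamma>" and "a \<le> b"
  shows "fst (\<gamma> b) - fst (\<gamma> a) = \<sigma> * (b - a)"
proof -
  have "norm ((fst (\<gamma> b) - \<sigma> * b) - (fst (\<gamma> a) - \<sigma> * a)) \<le> 0 * (b - a)"
  proof (rule lipschitz_AE_derivative_bound[OF \<open>a \<le> b\<close> order_refl])
    show "(C + \<bar>\<sigma>\<bar>)-lipschitz_on {a..b} (\<lambda>r. fst (\<gamma> r) - \<sigma> * r)"
    proof (rule lipschitz_on_diff)
      show "C-lipschitz_on {a..b} (\<lambda>r. fst (\<gamma> r))"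
        using lip unfolding lipschitz_on_def by (meson dist_fst_le order_trans)
      show "\<bar>\<sigma>\<bar>-lipschitz_on {a..b} (\<lambda>r. \<sigma> * r)"
        by (rule lipschitz_onI) (auto simp: dist_real_def simp flip: right_diff_distrib abs_mult)
    qed
    have "AE s in lborel. s \<in> {a<..<b} \<longrightarrow> ((\<lambda>r. fst (\<gamma> r)) has_real_derivative \<sigma>) (at s)"
      using fp by (simp add: flow_piece_def)
    then show "AE s in lborel. s \<in> {a<..<b} \<longrightarrow>
        (\<exists>d. ((\<lambda>r. fst (\<gamma> r) - \<sigma> * r) has_vector_derivative d) (at s) \<and> norm d \<le> 0)"
    proof eventually_elim
      case (elim s)
      show ?case
      proof
        assume "s \<in> {a<..<b}"
        then have "((\<lambda>r. fst (\<gamma> r)) has_real_derivative \<sigma>) (at s)" using elim by simp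
        then have "((\<lambda>r. fst (\<gamma> r) - \<sigma> * r) has_real_derivative 0) (at s)"
          by (auto intro!: derivative_eq_intros)
        then show "\<exists>d. ((\<lambda>r. fst (\<gamma> r) - \<sigma> * r) has_vector_derivative d) (at s) \<and> norm d \<le> 0"
          by (intro exI[of _ 0]) (simp add: has_real_derivative_iff_has_vector_derivative)
      qed
    qed
  qed
  then show ?thesis by (simp add: algebra_simps)
qed

section \<open>Dependence of a piece on the curve over its interval only\<close>

lemma has_vector_derivative_cong_interval:
  assumes "\<And>s. s \<in> {a..b} \<Longrightarrow> f s = g s" "s \<in> {a<..<b}"
  shows "(f has_vector_derivative d) (at s) \<longleftrightarrow> (g has_vector_derivative d) (at s)"
  using assms
  by (intro has_vector_derivative_cong_ev eventually_nhds_in_open[THEN eventually_mono, of "{a<..<b}"])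
    auto

lemma transversal_piece_cong:
  assumes "\<And>s. s \<in> {a..b} \<Longrightarrow> f s = g s" "a \<le> b"
  shows "transversal_piece T v f a b \<longleftrightarrow> transversal_piece T v g a b"
proof -
  have "(s \<in> {a<..<b} \<longrightarrow> (\<exists>d. (f has_vector_derivative d) (at s) \<and> norm d \<le> sup_norm T v)) \<longleftrightarrow>
      (s \<in> {a<..<b} \<longrightarrow> (\<exists>d. (g has_vector_derivative d) (at s) \<and> norm d \<le> sup_norm T v))" for s
    using has_vector_derivative_cong_interval[of a b f g s] assms(1) by simp
  then show ?thesis
    using assms unfolding transversal_piece_def by simp
qed

lemma flow_piece_cong:
  assumes "\<And>s. s \<in> {a..b} \<Longrightarrow> f s = g s"
  shows "flow_piece P Z \<sigma> f a b \<longleftrightarrow> flow_piece P Z \<sigma> g a b"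
proof -
  have "(s \<in> {a<..<b} \<longrightarrow> ((\<lambda>r. fst (f r)) has_real_derivative \<sigma>) (at s)) \<longleftrightarrow>
      (s \<in> {a<..<b} \<longrightarrow> ((\<lambda>r. fst (g r)) has_real_derivative \<sigma>) (at s))" for s
    using has_vector_derivative_cong_interval[of a b "\<lambda>r. fst (f r)" "\<lambda>r. fst (g r)" s] assms
    by (simp add: has_real_derivative_iff_has_vector_derivative)
  then show ?thesis
    using assms unfolding flow_piece_def by simp
qed

lemma parallel_piece_cong:
  assumes "\<And>s. s \<in> {a..b} \<Longrightarrow> f s = g s"
  shows "parallel_piece P Z f a b \<longleftrightarrow> parallel_piece P Z g a b"
  unfolding parallel_piece_def using flow_piece_cong[of a b f g] assms by blast

text \<open>On a nondegenerate interval the time coordinate would have derivative \<open>0\<close>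
  at every interior point and \<open>\<sigma> \<noteq> 0\<close> at almost every one. This prevents
  a piece from being charged to both lengths.\<close>

lemma transversal_not_parallel:
  assumes "transversal_piece T v \<gamma> a b" "a < b"
  shows "\<not> parallel_piece P Z \<gamma> a b"
proof
  assume "parallel_piece P Z \<gamma> a b"
  then obtain \<sigma> where \<sigma>: "\<sigma> \<noteq> 0" "flow_piece P Z \<sigma> \<gamma> a b"
    using that[of 1] that[of "-1"] unfolding parallel_piece_def by auto
  have const: "\<And>s. s \<in> {a..b} \<Longrightarrow> fst (\<gamma> s) = fst (\<gamma> a)"
    using assms(1) unfolding transversal_piece_def by blast
  have "\<not> ((\<lambda>r. fst (\<gamma> r)) has_real_derivative \<sigma>) (at s)" if "s \<in> {a<..<b}" for s
  proof
    assume "((\<lambda>r. fst (\<gamma> r)) has_real_derivative \<sigma>) (at s)"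
    then have "((\<lambda>r. fst (\<gamma> a)) has_vector_derivative \<sigma>) (at s)"
      using has_vector_derivative_cong_interval[of a b "\<lambda>r. fst (\<gamma> r)" "\<lambda>_. fst (\<gamma> a)" s, OF const that]
      unfolding has_real_derivative_iff_has_vector_derivative by blast
    then show False
      using \<sigma>(1) vector_derivative_unique_at[OF _ has_vector_derivative_const[of "fst (\<gamma> a)" "at s"]] by metis
  qed
  moreover have "AE s in lborel. s \<in> {a<..<b} \<longrightarrow> ((\<lambda>r. fst (\<gamma> r)) has_real_derivative \<sigma>) (at s)"
    using \<sigma>(2) unfolding flow_piece_def by blast
  ultimately have "AE s in lborel. s \<notin> {a<..<b}"
    by (auto elim!: eventually_mono)
  then have "{a<..<b} \<in> null_sets lborel"
    by (simp add: AE_iff_null_sets)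
  then show False using assms(2) by auto
qed

text \<open>Updates a length bound \<open>p\<close> when a piece covered by \<open>D\<close> is
  appended to those covered by \<open>B\<close>; as only an upper bound is wanted, shared endpoints
  do no harm.\<close>

lemma emeasure_le_extend:
  assumes "A \<subseteq> B \<union> D" "emeasure lborel B \<le> ennreal p" "emeasure lborel D \<le> ennreal r"
    "B \<in> sets lborel" "D \<in> sets lborel" "0 \<le> p" "0 \<le> r"
  shows "emeasure lborel A \<le> ennreal (p + r)"
proof -
  have "emeasure lborel A \<le> emeasure lborel (B \<union> D)"
    using assms by (intro emeasure_mono) auto
  also have "\<dots> \<le> emeasure lborel B + emeasure lborel D"
    using assms by (intro emeasure_subadditive)
  also have "\<dots> \<le> ennreal (p + r)"
    using assms by (simp add: ennreal_plus add_mono)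
  finally show ?thesis .
qed

lemma sets_pieces:
  "transversal_set T v \<gamma> I t \<in> sets lborel" "parallel_set P Z \<gamma> I t \<in> sets lborel"
  unfolding transversal_set_def parallel_set_def by (auto intro!: sets.finite_UN)

subsection \<open>Chains of jumps and moves along flow curves\<close>

locale flow_distances =
  fixes T :: real
    and v :: "real \<times> (real ^ 'n) \<Rightarrow> real \<times> (real ^ 'n)"
    and P :: "'a::topological_space set"
    and Z :: "real \<times> 'a \<Rightarrow> real \<times> (real ^ 'n)"
  assumes T_pos: "T > 0"
    and field_bounded: "bounded_Borel_field T v"
    and field_fst: "\<forall>x\<in>slab T. fst (v x) = 1"
    and field_unif_continuous: "space_unif_continuous T v"
    and flow: "multi_flow T v P Z"
    and dense: "slab T \<subseteq> closure (Z ` ({0..T} \<times> P))"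
begin

abbreviation "V \<equiv> sup_norm T v"

section \<open>Bounds on the field and on flow curves\<close>

lemma norm_field_le: "x \<in> slab T \<Longrightarrow> norm (v x) \<le> V"
proof -
  obtain B where "\<And>x. x \<in> slab T \<Longrightarrow> norm (v x) \<le> B"
    using field_bounded by (auto simp: bounded_Borel_field_def bounded_iff)
  then have "bdd_above ((\<lambda>x. norm (v x)) ` slab T)" by (intro bdd_aboveI2)
  then show "x \<in> slab T \<Longrightarrow> norm (v x) \<le> V" unfolding sup_norm_def by (rule cSUP_upper2) auto
qed

lemma V_ge_1: "V \<ge> 1"
proof -
  have *: "(0, 0) \<in> (slab T :: (real \<times> (real ^ 'n)) set)" using T_pos by auto
  have "norm (fst (v (0, 0))) \<le> norm (v (0, 0))"
    using norm_fst_le[of "fst (v (0, 0))" "snd (v (0, 0))"] by simp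
  moreover have "fst (v (0, 0)) = 1" using field_fst * by blast
  ultimately have "1 \<le> norm (v (0, 0))" by simp
  then show ?thesis using norm_field_le[OF *] by simp
qed

lemma Z_fst: "s \<in> {0..T} \<Longrightarrow> a \<in> P \<Longrightarrow> fst (Z (s, a)) = s"
  using flow by (auto simp: multi_flow_def)

lemma Z_in_slab: "s \<in> {0..T} \<Longrightarrow> a \<in> P \<Longrightarrow> Z (s, a) \<in> slab T"
  using Z_fst by (metis SigmaI UNIV_I prod.collapse)

lemma curve_lipschitz: "a \<in> P \<Longrightarrow> \<exists>C. C-lipschitz_on {0..T} (\<lambda>s. Z (s, a))"
  using flow by (auto simp: multi_flow_def)

lemma curve_derivative:
  "a \<in> P \<Longrightarrow> has_distributional_derivative 0 T (\<lambda>s. Z (s, a)) (\<lambda>s. v (Z (s, a)))"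
  using flow by (auto simp: multi_flow_def)

text \<open>The increment estimate is applied to the flow curve and the zero curve, because the
  field along a flow curve is bounded by \<open>V\<close>.\<close>

lemma curve_speed:
  assumes "a \<in> P" "s \<in> {0..T}" "s' \<in> {0..T}"
  shows "norm (Z (s', a) - Z (s, a)) \<le> V * \<bar>s' - s\<bar>"
  using assms(2,3)
proof (induction s s' rule: linorder_wlog)
  case (le s s')
  obtain C where C: "C-lipschitz_on {0..T} (\<lambda>s. Z (s, a))" using curve_lipschitz assms by blast
  have 0: "has_distributional_derivative 0 T (\<lambda>_. 0 :: real \<times> (real ^ 'n)) (\<lambda>_. 0)"
    by (simp add: has_distributional_derivative_def locally_integrable_def set_integrable_def
        set_lebesgue_integral_def)
  have "norm ((Z (s', a) - 0) - (Z (s, a) - 0)) \<le> V * (s' - s)"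
  proof (rule distributional_derivative_increment_le[OF curve_derivative[OF assms(1)] 0 C])
    show "0-lipschitz_on {0..T} (\<lambda>_. 0 :: real \<times> (real ^ 'n))" by (rule lipschitz_on_constant)
    show "AE t in lborel. t \<in> {s<..<s'} \<longrightarrow> norm (v (Z (t, a)) - 0) \<le> V"
      using le assms(1) by (intro AE_I2) (auto intro!: norm_field_le Z_in_slab)
  qed (use le V_ge_1 in auto)
  then show ?case using le by simp
next
  case (sym s s')
  then show ?case by (simp add: norm_minus_commute abs_minus_commute)
qed

text \<open>At time \<open>t\<close> both curves lie in the same time slice, so the uniform
  continuity of \<open>v\<close> in space bounds the derivative of their difference by
  \<open>\<rho>\<close> as long as they stay \<open>\<delta>\<close>-close.\<close>

lemma curve_difference:
  assumes ab: "a \<in> P" "b \<in> P" and "s \<in> {0..T}" "s' \<in> {0..T}" and "0 \<le> \<rho>"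
    and unif: "AE t in lborel. t \<in> {0..T} \<longrightarrow>
      (\<forall>x x'. norm (x - x') \<le> \<delta> \<longrightarrow> norm (v (t, x) - v (t, x')) \<le> \<rho>)"
    and close: "\<And>t. t \<in> {min s s'..max s s'} \<Longrightarrow> norm (Z (t, b) - Z (t, a)) \<le> \<delta>"
  shows "norm ((Z (s', b) - Z (s', a)) - (Z (s, b) - Z (s, a))) \<le> \<rho> * \<bar>s' - s\<bar>"
  using assms(3,4) close
proof (induction s s' rule: linorder_wlog)
  case (le s s')
  obtain Ca Cb where lip: "Ca-lipschitz_on {0..T} (\<lambda>s. Z (s, a))" "Cb-lipschitz_on {0..T} (\<lambda>s. Z (s, b))"
    using curve_lipschitz ab by blast
  have "norm ((Z (s', b) - Z (s', a)) - (Z (s, b) - Z (s, a))) \<le> \<rho> * (s' - s)"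
  proof (rule distributional_derivative_increment_le[OF curve_derivative[OF ab(2)] curve_derivative[OF ab(1)] lip(2,1)])
    show "AE t in lborel. t \<in> {s<..<s'} \<longrightarrow> norm (v (Z (t, b)) - v (Z (t, a))) \<le> \<rho>"
      using unif
    proof eventually_elim
      case (elim t)
      show ?case
      proof
        assume t: "t \<in> {s<..<s'}"
        then have "t \<in> {0..T}" using le by auto
        have "norm (snd (Z (t, b)) - snd (Z (t, a))) \<le> norm (Z (t, b) - Z (t, a))"
          by (metis norm_snd_le prod.collapse snd_diff)
        also have "\<dots> \<le> \<delta>" using le t by auto
        finally have "norm (v (t, snd (Z (t, b))) - v (t, snd (Z (t, a)))) \<le> \<rho>"
          using elim \<open>t \<in> {0..T}\<close> by blast
        moreover have "(t, snd (Z (t, b))) = Z (t, b)" "(t, snd (Z (t, a))) = Z (t, a)"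
          using Z_fst[OF \<open>t \<in> {0..T}\<close>] ab by (simp_all add: prod_eq_iff)
        ultimately show "norm (v (Z (t, b)) - v (Z (t, a))) \<le> \<rho>" by simp
      qed
    qed
  qed (use le \<open>0 \<le> \<rho>\<close> in auto)
  then show ?case using le by simp
next
  case (sym s s')
  then have "norm ((Z (s, b) - Z (s, a)) - (Z (s', b) - Z (s', a))) \<le> \<rho> * \<bar>s - s'\<bar>"
    by (simp add: min.commute max.commute)
  then show ?case
    unfolding norm_minus_commute[of "Z (s, b) - Z (s, a)"] abs_minus_commute[of s] .
qed

text \<open>In \<open>chain x y p q\<close>, \<open>p\<close> is the time spent along flow curves and \<open>q\<close> the time spent in jumps.\<close>

inductive chain :: "real \<times> (real ^ 'n) \<Rightarrow> real \<times> (real ^ 'n) \<Rightarrow> real \<Rightarrow> real \<Rightarrow> bool" where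
  refl: "x \<in> slab T \<Longrightarrow> chain x x 0 0"
| transversal: "chain x y p q \<Longrightarrow> z \<in> slab T \<Longrightarrow> fst z = fst y \<Longrightarrow> norm (z - y) \<le> V * r \<Longrightarrow> 0 \<le> r
    \<Longrightarrow> chain x z p (q + r)"
| parallel: "chain x (Z (s, a)) p q \<Longrightarrow> a \<in> P \<Longrightarrow> s \<in> {0..T} \<Longrightarrow> s' \<in> {0..T}
    \<Longrightarrow> chain x (Z (s', a)) (p + \<bar>s' - s\<bar>) q"

section \<open>Composition and reversal of chains\<close>

lemma chain_facts: "chain x y p q \<Longrightarrow> x \<in> slab T \<and> y \<in> slab T \<and> 0 \<le> p \<and> 0 \<le> q"
proof (induction rule: chain.induct)
  case (parallel x s a p q s')
  then show ?case using Z_in_slab[OF parallel(4,2)] by simp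
qed simp_all

lemma chain_transversal: "x \<in> slab T \<Longrightarrow> z \<in> slab T \<Longrightarrow> fst z = fst x \<Longrightarrow> norm (z - x) \<le> V * r \<Longrightarrow> 0 \<le> r
    \<Longrightarrow> chain x z 0 r"
  using chain.transversal[OF chain.refl] by force

lemma chain_parallel: "a \<in> P \<Longrightarrow> s \<in> {0..T} \<Longrightarrow> s' \<in> {0..T} \<Longrightarrow> chain (Z (s, a)) (Z (s', a)) \<bar>s' - s\<bar> 0"
  using chain.parallel[OF chain.refl[OF Z_in_slab]] by force

lemma chain_trans: "chain y z p' q' \<Longrightarrow> chain x y p q \<Longrightarrow> chain x z (p + p') (q + q')"
proof (induction rule: chain.induct)
  case (transversal y w p' q' z r)
  then show ?case using chain.transversal[of x w "p + p'" "q + q'" z r] by (simp add: add.assoc)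
next
  case (parallel y s a p' q' s')
  then show ?case using chain.parallel[of x s a "p + p'" "q + q'" s'] by (simp add: add.assoc)
qed simp

lemma chain_sym: "chain x y p q \<Longrightarrow> chain y x p q"
proof (induction rule: chain.induct)
  case (refl x)
  then show ?case by (rule chain.refl)
next
  case (transversal x y p q z r)
  have "chain z y 0 r"
    using transversal chain_facts[OF transversal(1)] by (intro chain_transversal) (auto simp: norm_minus_commute)
  from chain_trans[OF transversal(6) this] show ?case by (simp add: add.commute)
next
  case (parallel x s a p q s')
  have "chain (Z (s', a)) (Z (s, a)) \<bar>s - s'\<bar> 0" using parallel by (intro chain_parallel)
  from chain_trans[OF parallel(5) this] show ?case by (simp add: add.commute abs_minus_commute)
qed

text \<open>
  The crude bound is what keeps the chain \<open>\<delta>\<close>-close to the reference curve, so that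
  \<open>curve_difference\<close> applies at every step of the refined one.
\<close>

lemma chain_deviation:
  assumes "a \<in> P" "s0 \<in> {0..T}" "0 \<le> \<rho>"
    and unif: "AE t in lborel. t \<in> {0..T} \<longrightarrow>
      (\<forall>x x'. norm (x - x') \<le> \<delta> \<longrightarrow> norm (v (t, x) - v (t, x')) \<le> \<rho>)"
  shows "chain x y p q \<Longrightarrow> x = Z (s0, a) \<Longrightarrow>
    \<bar>fst y - s0\<bar> \<le> p \<and> norm (y - Z (fst y, a)) \<le> V * q + 2 * V * p \<and>
    (2 * V * (p + q) \<le> \<delta> \<longrightarrow> norm (y - Z (fst y, a)) \<le> V * q + \<rho> * p)"
proof (induction rule: chain.induct)
  case (refl x)
  then show ?case using Z_fst assms by simp
next
  case (transversal x y p q z r)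
  have "norm (z - Z (fst z, a)) \<le> norm (y - Z (fst y, a)) + V * r"
    using norm_triangle_ineq[of "z - y" "y - Z (fst y, a)"] transversal by simp
  moreover have "2 * V * (p + q) \<le> 2 * V * (p + (q + r))"
    using V_ge_1 transversal by (intro mult_left_mono) auto
  ultimately show ?case
    using transversal by (auto simp: algebra_simps)
next
  case (parallel x s b p q s')
  define e where "e t = norm (Z (t, b) - Z (t, a))" for t
  have fst_s: "fst (Z (s, b)) = s" "fst (Z (s', b)) = s'" using parallel Z_fst by auto
  have IH: "\<bar>s - s0\<bar> \<le> p" "e s \<le> V * q + 2 * V * p" "2 * V * (p + q) \<le> \<delta> \<Longrightarrow> e s \<le> V * q + \<rho> * p"
    using parallel.IH parallel.prems unfolding fst_s e_def by auto
  \<comment> \<open>The reference curve and the curve being followed both move with speed at most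
    \<open>V\<close>, hence the factor \<open>2 * V\<close>.\<close>
  have step: "e t \<le> e s + 2 * V * \<bar>t - s\<bar>" if "t \<in> {0..T}" for t
  proof -
    have "norm (Z (t, b) - Z (s, b)) \<le> V * \<bar>t - s\<bar>" "norm (Z (s, a) - Z (t, a)) \<le> V * \<bar>t - s\<bar>"
      using curve_speed[of b s t] curve_speed[of a t s] that parallel assms
      by (auto simp: abs_minus_commute)
    moreover have "e t \<le> norm (Z (t, b) - Z (s, b)) + norm (Z (s, b) - Z (t, a))"
      unfolding e_def by (rule norm_diff_triangle_le[OF order_refl order_refl])
    moreover have "norm (Z (s, b) - Z (t, a)) \<le> e s + norm (Z (s, a) - Z (t, a))"
      unfolding e_def by (rule norm_diff_triangle_le[OF order_refl order_refl])
    ultimately show ?thesis by linarith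
  qed
  have "0 \<le> q" "0 \<le> p" using chain_facts[OF parallel(1)] by auto
  have "e s' \<le> V * q + 2 * V * (p + \<bar>s' - s\<bar>)"
    using step[of s'] IH(2) parallel by (simp add: algebra_simps)
  moreover have "e s' \<le> V * q + \<rho> * (p + \<bar>s' - s\<bar>)" if \<delta>: "2 * V * ((p + \<bar>s' - s\<bar>) + q) \<le> \<delta>"
  proof -
    have "norm ((Z (s', b) - Z (s', a)) - (Z (s, b) - Z (s, a))) \<le> \<rho> * \<bar>s' - s\<bar>"
    proof (rule curve_difference[OF assms(1) \<open>b \<in> P\<close> parallel(3,4) \<open>0 \<le> \<rho>\<close> unif])
      fix t assume t: "t \<in> {min s s'..max s s'}"
      then have "\<bar>t - s\<bar> \<le> \<bar>s' - s\<bar>" "t \<in> {0..T}" using parallel by auto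
      then have "V * \<bar>t - s\<bar> \<le> V * \<bar>s' - s\<bar>" using V_ge_1 by (intro mult_left_mono) auto
      moreover have "0 \<le> V * q" using V_ge_1 \<open>0 \<le> q\<close> by simp
      ultimately show "norm (Z (t, b) - Z (t, a)) \<le> \<delta>"
        using step[OF \<open>t \<in> {0..T}\<close>] IH(2) \<delta> unfolding e_def[symmetric] by (simp add: algebra_simps)
    qed
    then have "e s' \<le> e s + \<rho> * \<bar>s' - s\<bar>"
      unfolding e_def using norm_triangle_ineq2[of "Z (s', b) - Z (s', a)" "Z (s, b) - Z (s, a)"] by linarith
    moreover have "2 * V * (p + q) \<le> 2 * V * ((p + \<bar>s' - s\<bar>) + q)"
      using V_ge_1 by (intro mult_left_mono) auto
    ultimately show ?thesis using IH(3) \<delta> by (simp add: algebra_simps)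
  qed
  moreover have "\<bar>s' - s0\<bar> \<le> p + \<bar>s' - s\<bar>" using IH(1) by linarith
  ultimately show ?case unfolding fst_s e_def by blast
qed

subsection \<open>Chains and competitors\<close>


text \<open>Only the values of the curve at the subdivision points survive: a transversal piece
  becomes a jump by the speed bound, a flow piece a move along its curve that lasts as long as the
  piece. A competitor run from \<open>y\<close> to \<open>x\<close> is turned round by
  \<open>chain_sym\<close>.\<close>

lemma competitor_imp_chain:
  assumes comp: "competitor T v P Z x y \<gamma> I t"
  shows "\<exists>p q. chain x y p q \<and>
    (\<forall>lam>0. ennreal (p + q / lam) \<le> weighted_length T v P Z lam \<gamma> I t)"
proof -
  define tr where "tr i \<longleftrightarrow> transversal_piece T v \<gamma> (t i) (t (i + 1))" for i
  define par where "par i \<longleftrightarrow> parallel_piece P Z \<gamma> (t i) (t (i + 1))" for i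
  \<comment> \<open>A degenerate piece may be of both kinds. It is counted as transversal and
    \<open>p\<close> collects the remaining pieces, so that each piece is counted exactly
    once.\<close>
  define p where "p k = (\<Sum>i\<in>{i\<in>{..<k}. \<not> tr i}. t (i + 1) - t i)" for k
  define q where "q k = (\<Sum>i\<in>{i\<in>{..<k}. tr i}. t (i + 1) - t i)" for k
  have t0: "t 0 = 0" and mono: "\<And>i. i \<le> I \<Longrightarrow> t i \<le> t (i + 1)"
    and slab: "\<gamma> ` {0..t (I + 1)} \<subseteq> slab T"
    and pieces: "\<And>i. i \<le> I \<Longrightarrow> tr i \<or> par i"
    and ends: "\<gamma> 0 = x \<and> \<gamma> (t (I + 1)) = y \<or> \<gamma> 0 = y \<and> \<gamma> (t (I + 1)) = x"
    using comp unfolding competitor_def tr_def par_def by blast+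
  obtain C where C: "C-lipschitz_on {0..t (I + 1)} \<gamma>"
    using comp unfolding competitor_def by blast
  have t_le: "t i \<le> t j" if "i \<le> j" "j \<le> I + 1" for i j
    using that
  proof (induction j rule: dec_induct)
    case (step k)
    then show ?case using mono[of k] by simp
  qed simp
  have in_slab: "\<gamma> (t k) \<in> slab T" if "k \<le> I + 1" for k
    using slab t_le[of 0 k] t_le[of k "I + 1"] that t0 by auto
  have "chain (\<gamma> 0) (\<gamma> (t k)) (p k) (q k)" if "k \<le> I + 1" for k
    using that
  proof (induction k)
    case 0
    have "\<gamma> 0 \<in> slab T" using in_slab[of 0] t0 by simp
    then show ?case using t0 chain.refl by (simp add: p_def q_def)
  next
    case (Suc k)
    then have IH: "chain (\<gamma> 0) (\<gamma> (t k)) (p k) (q k)" and "k \<le> I" by auto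
    have sub: "{t k..t (k + 1)} \<subseteq> {0..t (I + 1)}"
      using t_le[of 0 k] t_le[of "k + 1" "I + 1"] \<open>k \<le> I\<close> t0 by auto
    note lip = lipschitz_on_subset[OF C sub]
    have split: "{i\<in>{..<Suc k}. tr i} = (if tr k then insert k {i\<in>{..<k}. tr i} else {i\<in>{..<k}. tr i})"
      "{i\<in>{..<Suc k}. \<not> tr i} = (if tr k then {i\<in>{..<k}. \<not> tr i} else insert k {i\<in>{..<k}. \<not> tr i})"
      by (auto simp: less_Suc_eq)
    show ?case
    proof (cases "tr k")
      case True
      have "p (Suc k) = p k" "q (Suc k) = q k + (t (k + 1) - t k)"
        unfolding p_def q_def split using True by (simp_all add: add.commute)
      moreover have "chain (\<gamma> 0) (\<gamma> (t (k + 1))) (p k) (q k + (t (k + 1) - t k))"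
        using transversal_piece_increment[OF _ lip mono[OF \<open>k \<le> I\<close>], of T v] True V_ge_1
          mono[OF \<open>k \<le> I\<close>] in_slab[of "k + 1"] \<open>k \<le> I\<close>
        by (intro chain.transversal[OF IH]) (auto simp: tr_def)
      ultimately show ?thesis by simp
    next
      case False
      then have "par k" using pieces \<open>k \<le> I\<close> by blast
      then obtain \<sigma> where \<sigma>: "\<sigma> = 1 \<or> \<sigma> = -1" "flow_piece P Z \<sigma> \<gamma> (t k) (t (k + 1))"
        unfolding par_def parallel_piece_def by blast
      then obtain a where a: "a \<in> P" "\<And>s. s \<in> {t k..t (k + 1)} \<Longrightarrow> \<gamma> s = Z (fst (\<gamma> s), a)"
        unfolding flow_piece_def by blast
      have ends: "\<gamma> (t k) = Z (fst (\<gamma> (t k)), a)" "\<gamma> (t (k + 1)) = Z (fst (\<gamma> (t (k + 1))), a)"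
        using a(2)[of "t k"] a(2)[of "t (k + 1)"] mono[OF \<open>k \<le> I\<close>] by simp_all
      have fsts: "fst (\<gamma> (t k)) \<in> {0..T}" "fst (\<gamma> (t (k + 1))) \<in> {0..T}"
        using in_slab[of k] in_slab[of "k + 1"] \<open>k \<le> I\<close> by (auto simp: mem_Times_iff)
      have "\<bar>fst (\<gamma> (t (k + 1))) - fst (\<gamma> (t k))\<bar> = t (k + 1) - t k"
        using flow_piece_increment[OF \<sigma>(2) lip mono[OF \<open>k \<le> I\<close>]] \<sigma>(1) mono[OF \<open>k \<le> I\<close>]
        by (auto simp: abs_mult)
      moreover have "chain (\<gamma> 0) (Z (fst (\<gamma> (t (k + 1))), a))
          (p k + \<bar>fst (\<gamma> (t (k + 1))) - fst (\<gamma> (t k))\<bar>) (q k)"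
        by (rule chain.parallel[OF _ a(1) fsts]) (use IH ends(1) in simp)
      moreover have "q (Suc k) = q k" "p (Suc k) = p k + (t (k + 1) - t k)"
        unfolding p_def q_def split using False by (simp_all add: add.commute)
      ultimately show ?thesis using ends(2) by simp
    qed
  qed
  then have "chain (\<gamma> 0) (\<gamma> (t (I + 1))) (p (I + 1)) (q (I + 1))" by blast
  then have "chain x y (p (I + 1)) (q (I + 1))"
    using ends chain_sym by blast
  moreover have "ennreal (p (I + 1) + q (I + 1) / lam) \<le> weighted_length T v P Z lam \<gamma> I t"
    if "lam > 0" for lam
  proof -
    have "0 \<le> p (I + 1)" "0 \<le> q (I + 1)"
      unfolding p_def q_def using mono by (auto intro!: sum_nonneg)
    then have "ennreal (p (I + 1) + q (I + 1) / lam)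
        = ennreal (p (I + 1)) + ennreal (1 / lam) * ennreal (q (I + 1))"
      using that by (simp add: ennreal_plus ennreal_mult'[symmetric])
    also have "\<dots> \<le> weighted_length T v P Z lam \<gamma> I t"
      unfolding weighted_length_def
    proof (intro add_mono mult_left_mono)
      have "ennreal (p (I + 1)) \<le> emeasure lborel (\<Union>i\<in>{i\<in>{..<I + 1}. \<not> tr i}. {t i..t (i + 1)})"
        unfolding p_def by (rule sum_le_emeasure_UN_intervals[where n=I]) (use mono in auto)
      also have "\<dots> \<le> emeasure lborel (parallel_set P Z \<gamma> I t)"
      proof (rule emeasure_mono)
        have "{i\<in>{..<I + 1}. \<not> tr i} \<subseteq> {i. i \<le> I \<and> par i}"
          using pieces by (auto simp: less_Suc_eq_le)
        then show "(\<Union>i\<in>{i\<in>{..<I + 1}. \<not> tr i}. {t i..t (i + 1)}) \<subseteq> parallel_set P Z \<gamma> I t"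
          unfolding parallel_set_def par_def[symmetric] by blast
        show "parallel_set P Z \<gamma> I t \<in> sets lborel"
          unfolding parallel_set_def by (auto intro!: sets.finite_UN)
      qed
      finally show "ennreal (p (I + 1)) \<le> emeasure lborel (parallel_set P Z \<gamma> I t)" .
      have "ennreal (q (I + 1)) \<le> emeasure lborel (\<Union>i\<in>{i\<in>{..<I + 1}. tr i}. {t i..t (i + 1)})"
        unfolding q_def by (rule sum_le_emeasure_UN_intervals[where n=I]) (use mono in auto)
      also have "{i\<in>{..<I + 1}. tr i} = {i. i \<le> I \<and> tr i}" by auto
      finally show "ennreal (q (I + 1)) \<le> emeasure lborel (transversal_set T v \<gamma> I t)"
        unfolding transversal_set_def tr_def .
    qed simp_all
    finally show ?thesis .
  qed
  ultimately show ?thesis by blast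
qed

text \<open>A fixed direction makes \<open>y\<close> the end of the curve, where a further piece can
  be appended; \<open>competitor\<close> admits both directions.\<close>

definition oriented_competitor ::
    "real \<times> (real ^ 'n) \<Rightarrow> real \<times> (real ^ 'n) \<Rightarrow> (real \<Rightarrow> real \<times> (real ^ 'n)) \<Rightarrow> nat \<Rightarrow> (nat \<Rightarrow> real) \<Rightarrow> bool"
  where "oriented_competitor x y \<gamma> I t \<longleftrightarrow>
     t 0 = 0 \<and> (\<forall>i\<le>I. t i \<le> t (i + 1)) \<and>
     (\<exists>C. C-lipschitz_on {0..t (I + 1)} \<gamma>) \<and> \<gamma> ` {0..t (I + 1)} \<subseteq> slab T \<and>
     \<gamma> 0 = x \<and> \<gamma> (t (I + 1)) = y \<and>
     (\<forall>i\<le>I. transversal_piece T v \<gamma> (t i) (t (i + 1)) \<or> parallel_piece P Z \<gamma> (t i) (t (i + 1)))"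

text \<open>Old pieces keep their kinds after gluing, since a kind depends only on the curve over
  its interval. Both sets may grow, because a degenerate new piece can be of both kinds; inclusions
  suffice for bounding lengths from above.\<close>

lemma oriented_competitor_extend:
  assumes oc: "oriented_competitor x y \<gamma> I t" and "0 \<le> l"
    and S: "S = t (I + 1)" and \<eta>: "K-lipschitz_on {S..S + l} \<eta>" "\<eta> ` {S..S + l} \<subseteq> slab T" "\<eta> S = y" "\<eta> (S + l) = z"
    and piece: "transversal_piece T v \<eta> S (S + l) \<or> parallel_piece P Z \<eta> S (S + l)"
  shows "\<exists>\<gamma>' t'. oriented_competitor x z \<gamma>' (I + 1) t' \<and>
    transversal_set T v \<gamma>' (I + 1) t' \<subseteq> transversal_set T v \<gamma> I t
      \<union> (if transversal_piece T v \<eta> S (S + l) then {S..S + l} else {}) \<and>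
    parallel_set P Z \<gamma>' (I + 1) t' \<subseteq> parallel_set P Z \<gamma> I t
      \<union> (if parallel_piece P Z \<eta> S (S + l) then {S..S + l} else {})"
proof -
  define \<gamma>' where "\<gamma>' s = (if s \<le> S then \<gamma> s else \<eta> s)" for s
  define t' where "t' i = (if i \<le> I + 1 then t i else S + l)" for i
  have t0: "t 0 = 0" and mono: "\<And>i. i \<le> I \<Longrightarrow> t i \<le> t (i + 1)"
    and slab: "\<gamma> ` {0..S} \<subseteq> slab T"
    and pieces: "\<And>i. i \<le> I \<Longrightarrow> transversal_piece T v \<gamma> (t i) (t (i + 1)) \<or> parallel_piece P Z \<gamma> (t i) (t (i + 1))"
    and ends: "\<gamma> 0 = x" "\<gamma> S = y"
    using oc unfolding oriented_competitor_def S by blast+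
  obtain C where C: "C-lipschitz_on {0..S} \<gamma>"
    using oc unfolding oriented_competitor_def S by blast
  have t_le: "t i \<le> t j" if "i \<le> j" "j \<le> I + 1" for i j
    using that
  proof (induction j rule: dec_induct)
    case (step k)
    then show ?case using mono[of k] by simp
  qed simp
  have "0 \<le> S" using t_le[of 0 "I + 1"] t0 S by simp
  have t'_old: "t' i = t i" "t' (i + 1) = t (i + 1)" if "i \<le> I" for i
    using that by (simp_all add: t'_def)
  have t'_new: "t' (I + 1) = S" "t' (I + 1 + 1) = S + l"
    by (simp_all add: t'_def S)
  have \<gamma>'_old: "\<gamma>' s = \<gamma> s" if "s \<in> {t i..t (i + 1)}" "i \<le> I" for s i
    using that t_le[of "i + 1" "I + 1"] S by (auto simp: \<gamma>'_def)
  have \<gamma>'_new: "\<gamma>' s = \<eta> s" if "s \<in> {S..S + l}" for s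
    using that ends \<eta>(3) by (auto simp: \<gamma>'_def)
  have tr_old: "transversal_piece T v \<gamma>' (t' i) (t' (i + 1)) \<longleftrightarrow> transversal_piece T v \<gamma> (t i) (t (i + 1))"
    if "i \<le> I" for i
    unfolding t'_old[OF that] by (rule transversal_piece_cong[OF \<gamma>'_old[OF _ that] mono[OF that]])
  have par_old: "parallel_piece P Z \<gamma>' (t' i) (t' (i + 1)) \<longleftrightarrow> parallel_piece P Z \<gamma> (t i) (t (i + 1))"
    if "i \<le> I" for i
    unfolding t'_old[OF that] by (rule parallel_piece_cong[OF \<gamma>'_old[OF _ that]])
  have tr_new: "transversal_piece T v \<gamma>' (t' (I + 1)) (t' (I + 1 + 1)) \<longleftrightarrow> transversal_piece T v \<eta> S (S + l)"
    unfolding t'_new using \<gamma>'_new \<open>0 \<le> l\<close> by (intro transversal_piece_cong) auto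
  have par_new: "parallel_piece P Z \<gamma>' (t' (I + 1)) (t' (I + 1 + 1)) \<longleftrightarrow> parallel_piece P Z \<eta> S (S + l)"
    unfolding t'_new using \<gamma>'_new by (intro parallel_piece_cong) auto
  have cases: "i \<le> I \<or> i = I + 1" if "i \<le> I + 1" for i
    using that by auto
  have "oriented_competitor x z \<gamma>' (I + 1) t'"
    unfolding oriented_competitor_def
  proof (intro conjI allI impI)
    show "t' 0 = 0" using t0 by (simp add: t'_def)
    show "t' i \<le> t' (i + 1)" if "i \<le> I + 1" for i
      using cases[OF that] t'_old mono t'_new \<open>0 \<le> l\<close> by auto
    have "(max C K)-lipschitz_on {0..S + l} (\<lambda>s. if s \<le> S then \<gamma> s else \<eta> s)"
      using C \<eta>(1) by (rule lipschitz_on_concat_max) (simp add: ends \<eta>(3))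
    then show "\<exists>C. C-lipschitz_on {0..t' (I + 1 + 1)} \<gamma>'"
      unfolding t'_new \<gamma>'_def[abs_def] by blast
    show "\<gamma>' ` {0..t' (I + 1 + 1)} \<subseteq> slab T"
    proof (rule image_subsetI)
      fix s assume "s \<in> {0..t' (I + 1 + 1)}"
      then have "s \<in> {0..S} \<or> s \<in> {S..S + l} \<and> \<not> s \<le> S" unfolding t'_new by auto
      then show "\<gamma>' s \<in> slab T"
        unfolding \<gamma>'_def using slab \<eta>(2) by (auto simp only: if_True if_False atLeastAtMost_iff image_subset_iff)
    qed
    show "\<gamma>' 0 = x" using \<open>0 \<le> S\<close> ends by (simp add: \<gamma>'_def)
    show "\<gamma>' (t' (I + 1 + 1)) = z"
      unfolding t'_new using \<gamma>'_new[of "S + l"] \<open>0 \<le> l\<close> \<eta>(4) by simp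
    show "transversal_piece T v \<gamma>' (t' i) (t' (i + 1)) \<or> parallel_piece P Z \<gamma>' (t' i) (t' (i + 1))"
      if "i \<le> I + 1" for i
      using cases[OF that]
    proof
      assume "i \<le> I"
      then show ?thesis using pieces tr_old par_old by blast
    next
      assume "i = I + 1"
      then show ?thesis using piece tr_new par_new by blast
    qed
  qed
  moreover have "transversal_set T v \<gamma>' (I + 1) t' \<subseteq> transversal_set T v \<gamma> I t
      \<union> (if transversal_piece T v \<eta> S (S + l) then {S..S + l} else {})"
  proof
    fix s assume "s \<in> transversal_set T v \<gamma>' (I + 1) t'"
    then obtain i where i: "i \<le> I + 1" "transversal_piece T v \<gamma>' (t' i) (t' (i + 1))" "s \<in> {t' i..t' (i + 1)}"
      unfolding transversal_set_def by blast
    from cases[OF i(1)] show "s \<in> transversal_set T v \<gamma> I t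
      \<union> (if transversal_piece T v \<eta> S (S + l) then {S..S + l} else {})"
    proof
      assume "i \<le> I"
      then have "s \<in> transversal_set T v \<gamma> I t"
        using i tr_old t'_old unfolding transversal_set_def by auto
      then show ?thesis by blast
    next
      assume "i = I + 1"
      then show ?thesis using i tr_new t'_new by simp
    qed
  qed
  moreover have "parallel_set P Z \<gamma>' (I + 1) t' \<subseteq> parallel_set P Z \<gamma> I t
      \<union> (if parallel_piece P Z \<eta> S (S + l) then {S..S + l} else {})"
  proof
    fix s assume "s \<in> parallel_set P Z \<gamma>' (I + 1) t'"
    then obtain i where i: "i \<le> I + 1" "parallel_piece P Z \<gamma>' (t' i) (t' (i + 1))" "s \<in> {t' i..t' (i + 1)}"
      unfolding parallel_set_def by blast
    from cases[OF i(1)] show "s \<in> parallel_set P Z \<gamma> I t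
      \<union> (if parallel_piece P Z \<eta> S (S + l) then {S..S + l} else {})"
    proof
      assume "i \<le> I"
      then have "s \<in> parallel_set P Z \<gamma> I t"
        using i par_old t'_old unfolding parallel_set_def by auto
      then show ?thesis by blast
    next
      assume "i = I + 1"
      then show ?thesis using i par_new t'_new by simp
    qed
  qed
  ultimately show ?thesis by blast
qed

text \<open>Each step of the chain is realised by one appended piece, a straight segment for a jump
  and a reparametrised flow curve for a move. The set of the other kind grows by a null set at
  most.\<close>

lemma chain_imp_oriented_competitor:
  "chain x y p q \<Longrightarrow> \<exists>\<gamma> I t. oriented_competitor x y \<gamma> I t \<and>
    emeasure lborel (parallel_set P Z \<gamma> I t) \<le> ennreal p \<and>
    emeasure lborel (transversal_set T v \<gamma> I t) \<le> ennreal q"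
proof (induction rule: chain.induct)
  case (refl x)
  \<comment> \<open>A competitor has at least one piece, so the empty chain becomes a constant curve
    on the degenerate interval \<open>[0,0]\<close>.\<close>
  have tr: "transversal_piece T v (\<lambda>_. x) 0 0" by (simp add: transversal_piece_def)
  have null: "parallel_set P Z (\<lambda>_. x) 0 (\<lambda>_. 0) \<subseteq> {0}" "transversal_set T v (\<lambda>_. x) 0 (\<lambda>_. 0) \<subseteq> {0}"
    by (auto simp: parallel_set_def transversal_set_def)
  have "emeasure lborel (parallel_set P Z (\<lambda>_. x) 0 (\<lambda>_. 0)) \<le> emeasure lborel {0::real}"
    "emeasure lborel (transversal_set T v (\<lambda>_. x) 0 (\<lambda>_. 0)) \<le> emeasure lborel {0::real}"
    by (rule emeasure_mono[OF null(1)], simp) (rule emeasure_mono[OF null(2)], simp)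
  moreover have "oriented_competitor x x (\<lambda>_. x) 0 (\<lambda>_. 0)"
    using refl tr by (auto simp: oriented_competitor_def intro: lipschitz_on_constant)
  ultimately show ?case by (intro exI[of _ "\<lambda>_. x"] exI[of _ 0] exI[of _ "\<lambda>_. 0"]) simp
next
  case (transversal x y p q z r)
  obtain \<gamma> I t where IH: "oriented_competitor x y \<gamma> I t"
    "emeasure lborel (parallel_set P Z \<gamma> I t) \<le> ennreal p"
    "emeasure lborel (transversal_set T v \<gamma> I t) \<le> ennreal q"
    using transversal.IH by blast
  define S where "S = t (I + 1)"
  \<comment> \<open>When \<open>r = 0\<close> the bound on the jump forces \<open>z = y\<close>;
    division by zero then gives \<open>w = 0\<close>, and the resulting constant curve is still
    right.\<close>
  define w where "w = (1 / r) *\<^sub>R (z - y)"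
  define \<eta> where "\<eta> s = y + (s - S) *\<^sub>R w" for s
  have zy: "fst z = fst y" "y \<in> slab T" "0 \<le> r" using transversal chain_facts by auto
  have "norm w \<le> V"
    using transversal V_ge_1 by (cases "r = 0") (auto simp: w_def divide_le_eq mult.commute)
  have "fst (\<eta> s) = fst y" for s using zy by (simp add: \<eta>_def w_def)
  have "(\<eta> has_vector_derivative w) (at s)" for s
    unfolding \<eta>_def by (auto intro!: derivative_eq_intros)
  have tr: "transversal_piece T v \<eta> S (S + r)"
    unfolding transversal_piece_def
  proof (intro conjI ballI AE_I2 impI)
    show "fst (\<eta> s) = fst (\<eta> S)" for s
      by (simp only: \<open>\<And>s. fst (\<eta> s) = fst y\<close>)
    show "\<exists>d. (\<eta> has_vector_derivative d) (at s) \<and> norm d \<le> V" for s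
      using \<open>\<And>s. (\<eta> has_vector_derivative w) (at s)\<close> \<open>norm w \<le> V\<close> by blast
  qed
  have "\<exists>\<gamma>' t'. oriented_competitor x z \<gamma>' (I + 1) t' \<and>
    transversal_set T v \<gamma>' (I + 1) t' \<subseteq> transversal_set T v \<gamma> I t
      \<union> (if transversal_piece T v \<eta> S (S + r) then {S..S + r} else {}) \<and>
    parallel_set P Z \<gamma>' (I + 1) t' \<subseteq> parallel_set P Z \<gamma> I t
      \<union> (if parallel_piece P Z \<eta> S (S + r) then {S..S + r} else {})"
  proof (rule oriented_competitor_extend[OF IH(1) zy(3) S_def])
    show "(norm w)-lipschitz_on {S..S + r} \<eta>"
    proof (rule lipschitz_onI)
      fix s s'
      have "\<eta> s - \<eta> s' = (s - s') *\<^sub>R w" by (simp add: \<eta>_def algebra_simps)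
      then show "dist (\<eta> s) (\<eta> s') \<le> norm w * dist s s'"
        by (simp add: dist_norm mult.commute)
    qed simp
    show "\<eta> ` {S..S + r} \<subseteq> slab T"
      by (rule image_subsetI) (use zy(2) \<open>\<And>s. fst (\<eta> s) = fst y\<close> in \<open>simp add: mem_Times_iff\<close>)
    show "\<eta> S = y" by (simp add: \<eta>_def)
    show "\<eta> (S + r) = z"
      using transversal(4) by (cases "r = 0") (auto simp: \<eta>_def w_def)
    show "transversal_piece T v \<eta> S (S + r) \<or> parallel_piece P Z \<eta> S (S + r)" using tr by blast
  qed
  then obtain \<gamma>' t' where new: "oriented_competitor x z \<gamma>' (I + 1) t'"
    "transversal_set T v \<gamma>' (I + 1) t' \<subseteq> transversal_set T v \<gamma> I t \<union> {S..S + r}"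
    "parallel_set P Z \<gamma>' (I + 1) t' \<subseteq> parallel_set P Z \<gamma> I t
      \<union> (if parallel_piece P Z \<eta> S (S + r) then {S..S + r} else {})"
    unfolding if_P[OF tr] by blast
  have "r = 0" if "parallel_piece P Z \<eta> S (S + r)"
    using transversal_not_parallel[OF tr] that zy(3) by force
  then have "emeasure lborel (if parallel_piece P Z \<eta> S (S + r) then {S..S + r} else {}) \<le> ennreal 0"
    by auto
  then have "emeasure lborel (parallel_set P Z \<gamma>' (I + 1) t') \<le> ennreal (p + 0)"
    using chain_facts[OF transversal(1)] by (intro emeasure_le_extend[OF new(3) IH(2)] sets_pieces) auto
  moreover have "emeasure lborel (transversal_set T v \<gamma>' (I + 1) t') \<le> ennreal (q + r)"
    using chain_facts[OF transversal(1)] zy(3) by (intro emeasure_le_extend[OF new(2) IH(3)] sets_pieces) auto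
  ultimately show ?case using new(1) unfolding add_0_right by blast
next
  case (parallel x s a p q s')
  obtain \<gamma> I t where IH: "oriented_competitor x (Z (s, a)) \<gamma> I t"
    "emeasure lborel (parallel_set P Z \<gamma> I t) \<le> ennreal p"
    "emeasure lborel (transversal_set T v \<gamma> I t) \<le> ennreal q"
    using parallel.IH by blast
  define S where "S = t (I + 1)"
  \<comment> \<open>The sign records the direction in time, so that
    \<open>s + \<sigma> * (u - S)\<close> arrives at \<open>s'\<close> after the duration
    \<open>l\<close>.\<close>
  define \<sigma> :: real where "\<sigma> = (if s \<le> s' then 1 else -1)"
  define l where "l = \<bar>s' - s\<bar>"
  define \<eta> where "\<eta> u = Z (s + \<sigma> * (u - S), a)" for u
  have "0 \<le> l" and \<sigma>l: "s + \<sigma> * l = s'" "\<bar>\<sigma>\<bar> = 1" by (auto simp: l_def \<sigma>_def)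
  have time: "s + \<sigma> * (u - S) \<in> {0..T}" if "u \<in> {S..S + l}" for u
    using that parallel(3,4) by (auto simp: \<sigma>_def l_def)
  have fst_\<eta>: "fst (\<eta> u) = s + \<sigma> * (u - S)" if "u \<in> {S..S + l}" for u
    unfolding \<eta>_def using Z_fst[OF time[OF that] parallel(2)] .
  have "flow_piece P Z \<sigma> \<eta> S (S + l)"
    unfolding flow_piece_def
  proof (intro conjI bexI[of _ a] ballI AE_I2 impI)
    show "\<eta> u = Z (fst (\<eta> u), a)" if "u \<in> {S..S + l}" for u
      using fst_\<eta>[OF that] by (simp add: \<eta>_def)
    show "((\<lambda>r. fst (\<eta> r)) has_real_derivative \<sigma>) (at u)" if "u \<in> {S<..<S + l}" for u
    proof -
      have "((\<lambda>u. s + \<sigma> * (u - S)) has_real_derivative \<sigma>) (at u)"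
        by (auto intro!: derivative_eq_intros)
      then show ?thesis
        using has_vector_derivative_cong_interval[of S "S + l" "\<lambda>r. fst (\<eta> r)" "\<lambda>u. s + \<sigma> * (u - S)" u, OF fst_\<eta> that]
        by (simp only: has_real_derivative_iff_has_vector_derivative)
    qed
  qed (use parallel in auto)
  then have par: "parallel_piece P Z \<eta> S (S + l)"
    by (cases "s \<le> s'") (auto simp: parallel_piece_def \<sigma>_def)
  obtain C where C: "C-lipschitz_on {0..T} (\<lambda>s. Z (s, a))" using curve_lipschitz parallel by blast
  have "\<exists>\<gamma>' t'. oriented_competitor x (Z (s', a)) \<gamma>' (I + 1) t' \<and>
    transversal_set T v \<gamma>' (I + 1) t' \<subseteq> transversal_set T v \<gamma> I t
      \<union> (if transversal_piece T v \<eta> S (S + l) then {S..S + l} else {}) \<and>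
    parallel_set P Z \<gamma>' (I + 1) t' \<subseteq> parallel_set P Z \<gamma> I t
      \<union> (if parallel_piece P Z \<eta> S (S + l) then {S..S + l} else {})"
  proof (rule oriented_competitor_extend[OF IH(1) \<open>0 \<le> l\<close> S_def])
    show "C-lipschitz_on {S..S + l} \<eta>"
    proof (rule lipschitz_onI)
      fix u u' assume u: "u \<in> {S..S + l}" "u' \<in> {S..S + l}"
      have "dist (s + \<sigma> * (u - S)) (s + \<sigma> * (u' - S)) = \<bar>\<sigma>\<bar> * \<bar>u - u'\<bar>"
        by (simp add: dist_real_def flip: abs_mult) (simp add: algebra_simps)
      then show "dist (\<eta> u) (\<eta> u') \<le> C * dist u u'"
        using lipschitz_onD[OF C time[OF u(1)] time[OF u(2)]] \<sigma>l(2) by (simp add: \<eta>_def dist_real_def)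
    qed (use C lipschitz_on_nonneg in blast)
    show "\<eta> ` {S..S + l} \<subseteq> slab T"
      unfolding \<eta>_def using Z_in_slab[OF time parallel(2)] by blast
    show "\<eta> S = Z (s, a)" by (simp add: \<eta>_def)
    show "\<eta> (S + l) = Z (s', a)" using \<sigma>l(1) by (simp add: \<eta>_def)
    show "transversal_piece T v \<eta> S (S + l) \<or> parallel_piece P Z \<eta> S (S + l)" using par by blast
  qed
  then obtain \<gamma>' t' where new: "oriented_competitor x (Z (s', a)) \<gamma>' (I + 1) t'"
    "transversal_set T v \<gamma>' (I + 1) t' \<subseteq> transversal_set T v \<gamma> I t
      \<union> (if transversal_piece T v \<eta> S (S + l) then {S..S + l} else {})"
    "parallel_set P Z \<gamma>' (I + 1) t' \<subseteq> parallel_set P Z \<gamma> I t \<union> {S..S + l}"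
    unfolding if_P[OF par] by blast
  have "l = 0" if "transversal_piece T v \<eta> S (S + l)"
    using transversal_not_parallel[OF that] par \<open>0 \<le> l\<close> by force
  then have "emeasure lborel (if transversal_piece T v \<eta> S (S + l) then {S..S + l} else {}) \<le> ennreal 0"
    by auto
  then have "emeasure lborel (transversal_set T v \<gamma>' (I + 1) t') \<le> ennreal (q + 0)"
    using chain_facts[OF parallel(1)] by (intro emeasure_le_extend[OF new(2) IH(3)] sets_pieces) auto
  moreover have "emeasure lborel (parallel_set P Z \<gamma>' (I + 1) t') \<le> ennreal (p + l)"
    using chain_facts[OF parallel(1)] \<open>0 \<le> l\<close> by (intro emeasure_le_extend[OF new(3) IH(2)] sets_pieces) auto
  ultimately show ?case using new(1) unfolding l_def add_0_right by blast
qed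

lemma dist_lam_le_chain:
  assumes "chain x y p q" "lam > 0"
  shows "dist_lam T v P Z lam x y \<le> ennreal (p + q / lam)"
proof -
  obtain \<gamma> I t where c: "oriented_competitor x y \<gamma> I t"
    "emeasure lborel (parallel_set P Z \<gamma> I t) \<le> ennreal p"
    "emeasure lborel (transversal_set T v \<gamma> I t) \<le> ennreal q"
    using chain_imp_oriented_competitor[OF assms(1)] by blast
  have "competitor T v P Z x y \<gamma> I t"
    using c(1) unfolding oriented_competitor_def competitor_def by blast
  then have "dist_lam T v P Z lam x y \<le> weighted_length T v P Z lam \<gamma> I t"
    unfolding dist_lam_def by (intro Inf_lower) blast
  also have "\<dots> \<le> ennreal p + ennreal (1 / lam) * ennreal q"
    unfolding weighted_length_def using c by (intro add_mono mult_left_mono) auto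
  also have "\<dots> = ennreal (p + q / lam)"
    using assms chain_facts[OF assms(1)] by (simp add: ennreal_plus ennreal_mult'[symmetric])
  finally show ?thesis .
qed

subsection \<open>The distances as chain costs\<close>


text \<open>The real-valued counterpart of \<open>dist_lam\<close>. For positive \<open>lam\<close>
  the infimum is a proper one on the slab: chains join any two points, and their times are
  nonnegative.\<close>

definition cost :: "real \<Rightarrow> real \<times> (real ^ 'n) \<Rightarrow> real \<times> (real ^ 'n) \<Rightarrow> real" where
  "cost lam x y = Inf {p + q / lam | p q. chain x y p q}"

lemma cost_le:
  assumes "chain x y p q" "lam > 0"
  shows "cost lam x y \<le> p + q / lam"
  unfolding cost_def
proof (rule cInf_lower)
  show "bdd_below {p + q / lam | p q. chain x y p q}"
  proof (rule bdd_belowI[of _ 0])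
    fix c assume "c \<in> {p + q / lam | p q. chain x y p q}"
    then show "0 \<le> c" using chain_facts assms(2) by fastforce
  qed
qed (use assms in blast)

text \<open>Density yields a flow curve near \<open>x\<close>, but perhaps at another time. The time
  gap is at most the distance, and following the curve across it moves the point by at most
  \<open>V\<close> times as much; hence the factor \<open>1 + V\<close>.\<close>

lemma curve_through_approx:
  assumes x: "x \<in> slab T" and "e > 0"
  shows "\<exists>a\<in>P. norm (Z (fst x, a) - x) < e"
proof -
  have "e / (1 + V) > 0" using V_ge_1 \<open>e > 0\<close> by simp
  moreover have "x \<in> closure (Z ` ({0..T} \<times> P))" using dense x by blast
  ultimately obtain s a where sa: "s \<in> {0..T}" "a \<in> P" "dist (Z (s, a)) x < e / (1 + V)"
    by (auto simp: closure_approachable)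
  have "\<bar>s - fst x\<bar> \<le> dist (Z (s, a)) x"
    using dist_fst_le[of "Z (s, a)" x] Z_fst[OF sa(1,2)] by (simp add: dist_real_def)
  then have "V * \<bar>fst x - s\<bar> \<le> V * dist (Z (s, a)) x"
    using V_ge_1 by (intro mult_left_mono) (auto simp: abs_minus_commute)
  moreover have "norm (Z (fst x, a) - Z (s, a)) \<le> V * \<bar>fst x - s\<bar>"
    using x by (intro curve_speed sa) (auto simp: mem_Times_iff)
  moreover have "norm (Z (fst x, a) - x) \<le> norm (Z (fst x, a) - Z (s, a)) + dist (Z (s, a)) x"
    unfolding dist_norm by (rule norm_diff_triangle_le[OF order_refl order_refl])
  ultimately have "norm (Z (fst x, a) - x) \<le> (1 + V) * dist (Z (s, a)) x"
    by (simp add: algebra_simps)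
  also have "\<dots> < e"
    using sa(3) V_ge_1 by (simp add: less_divide_eq mult.commute)
  finally show ?thesis using sa(2) by blast
qed

text \<open>Jump from \<open>x\<close> to a nearby flow curve, follow it to the time of
  \<open>y\<close>, then jump to \<open>y\<close>.\<close>

lemma short_chain_exists:
  assumes x: "x \<in> slab T" and y: "y \<in> slab T" and "lam > 0" "e > 0"
  shows "\<exists>p q. chain x y p q \<and> p + q / lam \<le> (1 + (1 + V) / lam) * norm (y - x) + e"
proof -
  \<comment> \<open>The approximation error \<open>h\<close> enters both jumps, and
    \<open>2 * h / lam = e\<close>.\<close>
  define h where "h = e * lam / 2"
  have "h > 0" using assms by (simp add: h_def)
  then obtain a where a: "a \<in> P" "norm (Z (fst x, a) - x) < h"
    using curve_through_approx[OF x] by blast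
  define s where "s = fst x"
  define s' where "s' = fst y"
  have s: "s \<in> {0..T}" "s' \<in> {0..T}" using x y by (auto simp: s_def s'_def mem_Times_iff)
  have ss': "\<bar>s' - s\<bar> \<le> norm (y - x)"
    using dist_fst_le[of y x] by (simp add: s_def s'_def dist_norm)
  \<comment> \<open>Length of the last jump: \<open>norm (y - x)\<close> from \<open>y\<close> to
    \<open>x\<close>, at most \<open>h\<close> from \<open>x\<close> to the curve, and at most
    \<open>V * norm (y - x)\<close> along the curve.\<close>
  define r where "r = h + (1 + V) * norm (y - x)"
  have "r \<ge> 0" using \<open>h > 0\<close> V_ge_1 by (simp add: r_def)
  \<comment> \<open>As \<open>V \<ge> 1\<close>, a jump of length at most \<open>c\<close> can be
    made in time \<open>c\<close>.\<close>
  have le_V: "u \<le> V * c" if "u \<le> c" "0 \<le> c" for u c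
    using that V_ge_1 mult_right_mono[of 1 V c] by linarith
  have c1: "chain x (Z (s, a)) 0 h"
    using Z_fst[OF s(1) a(1)] a \<open>h > 0\<close> le_V[of "norm (Z (fst x, a) - x)" h]
    by (intro chain_transversal x Z_in_slab[OF s(1) a(1)]) (auto simp: s_def)
  have "norm (y - Z (s', a)) \<le> r"
  proof -
    have "norm (y - Z (s', a)) \<le> norm (y - x) + norm (x - Z (s', a))"
      by (rule norm_diff_triangle_le[OF order_refl order_refl])
    moreover have "norm (x - Z (s', a)) \<le> norm (x - Z (s, a)) + norm (Z (s, a) - Z (s', a))"
      by (rule norm_diff_triangle_le[OF order_refl order_refl])
    moreover have "norm (x - Z (s, a)) < h" using a(2) by (simp add: s_def norm_minus_commute)
    moreover have "norm (Z (s, a) - Z (s', a)) \<le> V * \<bar>s - s'\<bar>"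
      by (rule curve_speed[OF a(1) s(2,1)])
    moreover have "V * \<bar>s - s'\<bar> \<le> V * norm (y - x)"
      using ss' V_ge_1 by (intro mult_left_mono) (auto simp: abs_minus_commute)
    ultimately show ?thesis by (simp add: r_def algebra_simps)
  qed
  then have c3: "chain (Z (s', a)) y 0 r"
    using Z_fst[OF s(2) a(1)] \<open>r \<ge> 0\<close> le_V
    by (intro chain_transversal y Z_in_slab[OF s(2) a(1)]) (auto simp: s'_def)
  have "chain x y (0 + \<bar>s' - s\<bar> + 0) (h + 0 + r)"
    by (rule chain_trans[OF c3 chain_trans[OF chain_parallel[OF a(1) s] c1]])
  then have "chain x y \<bar>s' - s\<bar> (h + r)" by simp
  moreover have "\<bar>s' - s\<bar> + (h + r) / lam \<le> (1 + (1 + V) / lam) * norm (y - x) + e"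
  proof -
    have "(h + r) / lam = e + (1 + V) / lam * norm (y - x)"
      using \<open>lam > 0\<close> by (simp add: r_def h_def field_simps)
    then show ?thesis using ss' by (simp add: algebra_simps)
  qed
  ultimately show ?thesis by blast
qed

lemma cost_less_imp_chain:
  assumes "x \<in> slab T" "y \<in> slab T" "lam > 0" "cost lam x y < c"
  shows "\<exists>p q. chain x y p q \<and> p + q / lam < c"
proof -
  have "{p + q / lam | p q. chain x y p q} \<noteq> {}"
    using short_chain_exists[OF assms(1-3), of 1] by auto
  from cInf_lessD[OF this assms(4)[unfolded cost_def]] show ?thesis by blast
qed

section \<open>Pseudometric properties of the cost\<close>

lemma cost_nonneg:
  assumes "x \<in> slab T" "y \<in> slab T" "lam > 0"
  shows "0 \<le> cost lam x y"
proof (rule ccontr)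
  assume "\<not> 0 \<le> cost lam x y"
  then obtain p q where "chain x y p q" "p + q / lam < 0"
    using cost_less_imp_chain[OF assms, of 0] by auto
  moreover from this have "0 \<le> p + q / lam" using chain_facts[of x y p q] assms(3) by simp
  ultimately show False by simp
qed

lemma cost_le_norm:
  assumes "x \<in> slab T" "y \<in> slab T" "lam > 0"
  shows "cost lam x y \<le> (1 + (1 + V) / lam) * norm (y - x)"
proof (rule field_le_epsilon)
  fix e :: real assume "e > 0"
  then obtain p q where pq: "chain x y p q" "p + q / lam \<le> (1 + (1 + V) / lam) * norm (y - x) + e"
    using short_chain_exists[OF assms] by blast
  show "cost lam x y \<le> (1 + (1 + V) / lam) * norm (y - x) + e"
    using order_trans[OF cost_le[OF pq(1) assms(3)] pq(2)] .
qed

lemma cost_sym: "cost lam x y = cost lam y x"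
  unfolding cost_def using chain_sym by metis

lemma cost_triangle:
  assumes "x \<in> slab T" "y \<in> slab T" "z \<in> slab T" "lam > 0"
  shows "cost lam x z \<le> cost lam x y + cost lam y z"
proof (rule field_le_epsilon)
  fix e :: real assume "e > 0"
  obtain p q where 1: "chain x y p q" "p + q / lam < cost lam x y + e / 2"
    using cost_less_imp_chain[OF assms(1,2,4), of "cost lam x y + e / 2"] \<open>e > 0\<close> by auto
  obtain p' q' where 2: "chain y z p' q'" "p' + q' / lam < cost lam y z + e / 2"
    using cost_less_imp_chain[OF assms(2,3,4), of "cost lam y z + e / 2"] \<open>e > 0\<close> by auto
  have "cost lam x z \<le> (p + p') + (q + q') / lam"
    by (rule cost_le[OF chain_trans[OF 2(1) 1(1)] assms(4)])
  then show "cost lam x z \<le> cost lam x y + cost lam y z + e"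
    using 1(2) 2(2) by (simp add: add_divide_distrib)
qed

text \<open>A fixed chain gets cheaper as \<open>lam\<close> grows, because its jump time is divided
  by \<open>lam\<close>; near-optimal chains carry this over to the infimum.\<close>

lemma cost_antimono:
  assumes "x \<in> slab T" "y \<in> slab T" "0 < lam" "lam \<le> lam'"
  shows "cost lam' x y \<le> cost lam x y"
proof (rule field_le_epsilon)
  fix e :: real assume "e > 0"
  then obtain p q where pq: "chain x y p q" "p + q / lam < cost lam x y + e"
    using cost_less_imp_chain[OF assms(1-3), of "cost lam x y + e"] by auto
  have "cost lam' x y \<le> p + q / lam'" using pq(1) assms by (intro cost_le) auto
  also have "q / lam' \<le> q / lam"
    using chain_facts[OF pq(1)] assms by (intro divide_left_mono) auto
  finally show "cost lam' x y \<le> cost lam x y + e" using pq(2) by simp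
qed

text \<open>The triangle inequality moves one endpoint at a time, which doubles the constant. The
  resulting joint continuity closes the sets of the later compactness argument.\<close>

lemma cost_lipschitz:
  assumes "lam > 0"
  shows "(2 * (1 + (1 + V) / lam))-lipschitz_on (slab T \<times> slab T) (\<lambda>w. cost lam (fst w) (snd w))"
proof (rule lipschitz_onI)
  let ?C = "1 + (1 + V) / lam"
  have "?C \<ge> 0" using assms V_ge_1 by simp
  then show "0 \<le> 2 * ?C" by (rule mult_nonneg_nonneg[OF zero_le_numeral])
  have le: "cost lam x y - cost lam x' y' \<le> 2 * ?C * dist (x, y) (x', y')"
    if "x \<in> slab T" "y \<in> slab T" "x' \<in> slab T" "y' \<in> slab T" for x y x' y'
  proof -
    have "cost lam x y \<le> cost lam x x' + cost lam x' y" "cost lam x' y \<le> cost lam x' y' + cost lam y' y"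
      using cost_triangle that assms by auto
    moreover have "cost lam x x' \<le> ?C * norm (x' - x)" "cost lam y' y \<le> ?C * norm (y - y')"
      using cost_le_norm that assms by auto
    moreover have "norm (x' - x) \<le> dist (x, y) (x', y')" "norm (y - y') \<le> dist (x, y) (x', y')"
      using dist_fst_le[of "(x, y)" "(x', y')"] dist_snd_le[of "(x, y)" "(x', y')"]
      by (auto simp: dist_norm norm_minus_commute)
    then have "?C * norm (x' - x) \<le> ?C * dist (x, y) (x', y')" "?C * norm (y - y') \<le> ?C * dist (x, y) (x', y')"
      using \<open>?C \<ge> 0\<close> by (auto intro: mult_left_mono)
    ultimately show ?thesis by linarith
  qed
  fix w w' :: "(real \<times> (real ^ 'n)) \<times> (real \<times> (real ^ 'n))"
  assume w: "w \<in> slab T \<times> slab T" "w' \<in> slab T \<times> slab T"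
  obtain x y where w_eq: "w = (x, y)" by (cases w)
  obtain x' y' where w'_eq: "w' = (x', y')" by (cases w')
  note eq = w_eq w'_eq
  have in_slab: "x \<in> slab T" "y \<in> slab T" "x' \<in> slab T" "y' \<in> slab T" using w unfolding eq by blast+
  show "dist (cost lam (fst w) (snd w)) (cost lam (fst w') (snd w')) \<le> 2 * ?C * dist w w'"
    using le[OF in_slab] le[OF in_slab(3,4,1,2)]
    unfolding eq dist_real_def dist_commute[of "(x', y')"] fst_conv snd_conv by linarith
qed

lemma dist_lam_eq_cost:
  assumes "x \<in> slab T" "y \<in> slab T" "lam > 0"
  shows "dist_lam T v P Z lam x y = ennreal (cost lam x y)"
proof (rule antisym)
  show "dist_lam T v P Z lam x y \<le> ennreal (cost lam x y)"
  proof (rule ennreal_le_epsilon)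
    fix e :: real assume "e > 0"
    then obtain p q where pq: "chain x y p q" "p + q / lam < cost lam x y + e"
      using cost_less_imp_chain[OF assms, of "cost lam x y + e"] by auto
    have "dist_lam T v P Z lam x y \<le> ennreal (p + q / lam)"
      by (rule dist_lam_le_chain[OF pq(1) assms(3)])
    also have "\<dots> \<le> ennreal (cost lam x y + e)" using pq(2) by (intro ennreal_leI) simp
    finally show "dist_lam T v P Z lam x y \<le> ennreal (cost lam x y) + ennreal e"
      using cost_nonneg[OF assms] \<open>e > 0\<close> by (simp add: ennreal_plus)
  qed
  show "ennreal (cost lam x y) \<le> dist_lam T v P Z lam x y"
    unfolding dist_lam_def
  proof (rule Inf_greatest)
    fix c assume "c \<in> {weighted_length T v P Z lam \<gamma> I t | \<gamma> I t. competitor T v P Z x y \<gamma> I t}"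
    then obtain \<gamma> I t where c: "c = weighted_length T v P Z lam \<gamma> I t" "competitor T v P Z x y \<gamma> I t"
      by blast
    then obtain p q where "chain x y p q" "ennreal (p + q / lam) \<le> c"
      using competitor_imp_chain[OF c(2)] assms(3) by blast
    moreover from this have "ennreal (cost lam x y) \<le> ennreal (p + q / lam)"
      using assms(3) by (intro ennreal_leI cost_le)
    ultimately show "ennreal (cost lam x y) \<le> c" by (rule_tac order_trans)
  qed
qed

lemma cost_le_dist_zero:
  assumes "x \<in> slab T" "y \<in> slab T" "lam \<in> {0<..1}"
  shows "ennreal (cost lam x y) \<le> dist_zero T v P Z x y"
  unfolding dist_zero_def using assms
  by (intro SUP_upper2[of lam]) (auto simp: dist_lam_eq_cost)

text \<open>A move along a single curve contains no jump, so the same cost bound holds for every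
  \<open>lam\<close> and survives the supremum.\<close>

lemma dist_zero_along_curve:
  assumes "a \<in> P" "s \<in> {0..T}" "s' \<in> {0..T}"
  shows "dist_zero T v P Z (Z (s, a)) (Z (s', a)) \<le> ennreal \<bar>s' - s\<bar>"
  unfolding dist_zero_def
proof (rule SUP_least)
  fix lam :: real assume "lam \<in> {0<..1}"
  then show "dist_lam T v P Z lam (Z (s, a)) (Z (s', a)) \<le> ennreal \<bar>s' - s\<bar>"
    using dist_lam_le_chain[OF chain_parallel[OF assms], of lam] by simp
qed

end

subsection \<open>Extension of directionally Lipschitz functions\<close>

locale directional_extension = flow_distances T v P Z
  for T :: real
    and v :: "real \<times> (real ^ 'n) \<Rightarrow> real \<times> (real ^ 'n)"
    and P :: "'a::topological_space set"
    and Z :: "real \<times> 'a \<Rightarrow> real \<times> (real ^ 'n)" +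
  fixes A :: "'a set" and \<phi> :: "real \<times> (real ^ 'n) \<Rightarrow> real" and L M \<epsilon> :: real
  assumes L_pos: "L > 0" and M_pos: "M > 0" and \<epsilon>_pos: "\<epsilon> > 0"
    and A_sub: "A \<subseteq> P"
    and tube_compact: "compact (flow_tube T Z A)"
    and lipschitz: "M-lipschitz_on (flow_tube T Z A) \<phi>"
    and directional: "directionally_lipschitz_on T v P Z L (flow_tube T Z A) \<phi>"
begin

abbreviation "K \<equiv> flow_tube T Z A"

lemma K_sub: "K \<subseteq> slab T"
  unfolding flow_tube_def using Z_in_slab A_sub by blast

section \<open>Increments of \<open>\<phi>\<close> on the flow-tube\<close>

lemma along_curve:
  assumes "a \<in> A" "s \<in> {0..T}" "s' \<in> {0..T}"
  shows "\<bar>\<phi> (Z (s', a)) - \<phi> (Z (s, a))\<bar> \<le> L * \<bar>s' - s\<bar>"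
proof -
  have "Z (s, a) \<in> K" "Z (s', a) \<in> K" using assms by (auto simp: flow_tube_def)
  then have "ennreal \<bar>\<phi> (Z (s', a)) - \<phi> (Z (s, a))\<bar> \<le> ennreal L * dist_zero T v P Z (Z (s, a)) (Z (s', a))"
    using directional by (auto simp: directionally_lipschitz_on_def)
  also have "\<dots> \<le> ennreal L * ennreal \<bar>s' - s\<bar>"
    using assms A_sub by (intro mult_left_mono dist_zero_along_curve) auto
  also have "\<dots> = ennreal (L * \<bar>s' - s\<bar>)" using L_pos by (simp add: ennreal_mult')
  finally show ?thesis using L_pos by (simp add: ennreal_le_iff)
qed

lemma short_chain_increment:
  assumes "\<rho> > 0"
  shows "\<exists>\<delta>>0. \<forall>x\<in>K. \<forall>y\<in>K. \<forall>p q. chain x y p q \<and> p + q \<le> \<delta> \<longrightarrow>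
    \<bar>\<phi> y - \<phi> x\<bar> \<le> L * p + M * (V * q + \<rho> * p)"
proof -
  obtain \<delta> where \<delta>: "\<delta> > 0" "AE t in lborel. t \<in> {0..T} \<longrightarrow>
      (\<forall>x x'. norm (x - x') \<le> \<delta> \<longrightarrow> norm (v (t, x) - v (t, x')) \<le> \<rho>)"
    using field_unif_continuous assms unfolding space_unif_continuous_def by blast
  \<comment> \<open>Total time \<open>\<delta> / (2 * V)\<close> is exactly the smallness under
    which \<open>chain_deviation\<close> gives its refined bound.\<close>
  show ?thesis
  proof (intro exI[of _ "\<delta> / (2 * V)"] conjI ballI allI impI)
    show "\<delta> / (2 * V) > 0" using \<delta>(1) V_ge_1 by simp
    fix x y p q assume "x \<in> K" "y \<in> K" and "chain x y p q \<and> p + q \<le> \<delta> / (2 * V)"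
    then have ch: "chain x y p q" and pq: "2 * V * (p + q) \<le> \<delta>"
      using V_ge_1 by (auto simp: le_divide_eq mult.commute)
    obtain s a where sa: "s \<in> {0..T}" "a \<in> A" "x = Z (s, a)" using \<open>x \<in> K\<close> by (auto simp: flow_tube_def)
    have "fst y \<in> {0..T}" using K_sub \<open>y \<in> K\<close> by (auto simp: mem_Times_iff)
    \<comment> \<open>The tube contains whole flow curves over \<open>[0,T]\<close>, so this
      comparison point belongs to it and both hypotheses on \<open>\<phi>\<close> apply
      there.\<close>
    define z where "z = Z (fst y, a)"
    have "z \<in> K" using sa \<open>fst y \<in> {0..T}\<close> by (auto simp: flow_tube_def z_def)
    have dev: "\<bar>fst y - s\<bar> \<le> p" "norm (y - z) \<le> V * q + \<rho> * p"
      using chain_deviation[OF _ sa(1) _ \<delta>(2) ch sa(3)] sa(2) A_sub assms pq unfolding z_def by auto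
    have "\<bar>\<phi> z - \<phi> x\<bar> \<le> L * \<bar>fst y - s\<bar>"
      unfolding z_def sa(3) by (rule along_curve[OF sa(2,1) \<open>fst y \<in> {0..T}\<close>])
    also have "\<dots> \<le> L * p" using dev(1) L_pos by simp
    finally have "\<bar>\<phi> z - \<phi> x\<bar> \<le> L * p" .
    moreover have "\<bar>\<phi> y - \<phi> z\<bar> \<le> M * norm (y - z)"
      using lipschitz_onD[OF lipschitz \<open>y \<in> K\<close> \<open>z \<in> K\<close>] by (simp add: dist_norm)
    moreover have "M * norm (y - z) \<le> M * (V * q + \<rho> * p)" using dev(2) M_pos by simp
    ultimately show "\<bar>\<phi> y - \<phi> x\<bar> \<le> L * p + M * (V * q + \<rho> * p)" by linarith
  qed
qed

lemma lipschitz_at_small_scale: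
  "\<exists>\<delta>>0. \<exists>lam0\<in>{0<..1}. \<forall>lam\<in>{0<..lam0}. \<forall>x\<in>K. \<forall>y\<in>K.
    cost lam x y < \<delta> \<longrightarrow> \<bar>\<phi> y - \<phi> x\<bar> \<le> (L + \<epsilon>) * cost lam x y"
proof -
  \<comment> \<open>The choice \<open>\<rho> = \<epsilon> / M\<close> turns the drift term
    \<open>M * \<rho> * p\<close> into \<open>\<epsilon> * p\<close>.\<close>
  have "\<epsilon> / M > 0" using \<epsilon>_pos M_pos by simp
  from short_chain_increment[OF this] obtain \<delta> where "\<delta> > 0"
    and \<delta>: "\<forall>x\<in>K. \<forall>y\<in>K. \<forall>p q. chain x y p q \<and> p + q \<le> \<delta> \<longrightarrow>
      \<bar>\<phi> y - \<phi> x\<bar> \<le> L * p + M * (V * q + \<epsilon> / M * p)"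
    by (elim exE conjE)
  \<comment> \<open>Below \<open>\<epsilon> / (M * V)\<close> the weight \<open>1 / lam\<close>
    makes jumps expensive enough to pay for \<open>M * V * q\<close>; the cap \<open>1\<close>
    ensures \<open>q \<le> q / lam\<close>.\<close>
  define lam0 where "lam0 = min 1 (\<epsilon> / (M * V))"
  have lam0: "lam0 \<in> {0<..1}" using \<epsilon>_pos M_pos V_ge_1 by (auto simp: lam0_def)
  have "\<bar>\<phi> y - \<phi> x\<bar> \<le> (L + \<epsilon>) * cost lam x y"
    if lam: "lam \<in> {0<..lam0}" and xy: "x \<in> K" "y \<in> K" and small: "cost lam x y < \<delta>" for lam x y
  proof -
    have slab: "x \<in> slab T" "y \<in> slab T" and "lam > 0" using K_sub xy lam by auto
    \<comment> \<open>The infimum need not be attained; any \<open>c\<close> strictly between it and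
      \<open>\<delta>\<close> still provides a chain short enough for the local estimate.\<close>
    have "\<bar>\<phi> y - \<phi> x\<bar> / (L + \<epsilon>) \<le> c" if c: "cost lam x y < c" "c < \<delta>" for c
    proof -
      obtain p q where pq: "chain x y p q" "p + q / lam < c"
        using cost_less_imp_chain[OF slab \<open>lam > 0\<close> c(1)] by blast
      have nonneg: "0 \<le> p" "0 \<le> q" using chain_facts[OF pq(1)] by auto
      have "q \<le> q / lam" using nonneg lam lam0 by (simp add: le_divide_eq mult_left_le)
      then have "p + q \<le> \<delta>" using pq(2) c(2) by linarith
      then have "\<bar>\<phi> y - \<phi> x\<bar> \<le> L * p + M * (V * q + \<epsilon> / M * p)"
        using \<delta> xy pq(1) by blast
      also have "\<dots> = (L + \<epsilon>) * p + M * V * q" using M_pos by (simp add: field_simps)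
      also have "M * V * q \<le> \<epsilon> * (q / lam)"
      proof -
        have "lam \<le> \<epsilon> / (M * V)" using lam by (auto simp: lam0_def)
        then have "M * V \<le> \<epsilon> / lam"
          using \<open>lam > 0\<close> M_pos V_ge_1 by (simp add: le_divide_eq mult.commute)
        then have "M * V * q \<le> \<epsilon> / lam * q" using nonneg by (intro mult_right_mono)
        then show ?thesis by simp
      qed
      also have "\<epsilon> * (q / lam) \<le> (L + \<epsilon>) * (q / lam)"
        using L_pos nonneg \<open>lam > 0\<close> by (intro mult_right_mono) auto
      finally have "\<bar>\<phi> y - \<phi> x\<bar> \<le> (L + \<epsilon>) * (p + q / lam)" by (simp add: algebra_simps)
      also have "\<dots> \<le> (L + \<epsilon>) * c" using pq(2) L_pos \<epsilon>_pos by simp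
      finally show ?thesis using L_pos \<epsilon>_pos by (simp add: divide_le_eq mult.commute)
    qed
    then have "\<bar>\<phi> y - \<phi> x\<bar> / (L + \<epsilon>) \<le> cost lam x y"
      using small by (rule dense_ge_bounded[rotated])
    then show ?thesis using L_pos \<epsilon>_pos by (simp add: divide_le_eq mult.commute)
  qed
  then show ?thesis using \<open>\<delta> > 0\<close> lam0 by blast
qed

text \<open>
  If this fails for every \<open>lam\<close>, then the counterexamples have \<open>cost \<ge> \<delta>\<close> and form nested nonempty
  compact sets; a common point contradicts the directional Lipschitz bound.
\<close>

lemma lipschitz_for_cost:
  "\<exists>lam\<in>{0<..1}. \<forall>x\<in>K. \<forall>y\<in>K. \<bar>\<phi> y - \<phi> x\<bar> \<le> (L + \<epsilon>) * cost lam x y"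
proof (rule ccontr)
  assume neg: "\<not> ?thesis"
  obtain \<delta> lam0 where "\<delta> > 0" and lam0: "lam0 \<in> {0<..1}"
    and local: "\<And>lam x y. lam \<in> {0<..lam0} \<Longrightarrow> x \<in> K \<Longrightarrow> y \<in> K \<Longrightarrow> cost lam x y < \<delta> \<Longrightarrow>
      \<bar>\<phi> y - \<phi> x\<bar> \<le> (L + \<epsilon>) * cost lam x y"
    using lipschitz_at_small_scale by blast
  define lam where "lam k = lam0 / real (Suc k)" for k
  have lam: "lam k \<in> {0<..lam0}" "lam k \<in> {0<..1}" for k
    using lam0 by (auto simp: lam_def divide_le_eq mult_left_le intro: order_trans[of _ lam0])
  have lam_antimono: "lam n \<le> lam m" if "m \<le> n" for m n
    using that lam0 by (auto simp: lam_def intro!: divide_left_mono)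
  \<comment> \<open>The strict inequality of a counterexample is relaxed so that the sets are
    closed. The maximum with \<open>\<delta>\<close> compensates for this: it keeps the increment of
    \<open>\<phi>\<close> away from zero at the common point.\<close>
  define F where "F k = {w \<in> K \<times> K. (L + \<epsilon>) * max \<delta> (cost (lam k) (fst w) (snd w)) \<le> \<bar>\<phi> (snd w) - \<phi> (fst w)\<bar>}" for k
  have "\<Inter>(range F) \<noteq> {}"
  proof (rule compact_nest)
    fix k
    have KK: "compact (K \<times> K)" using tube_compact by (intro compact_Times)
    have "continuous_on (K \<times> K) (\<lambda>w. cost (lam k) (fst w) (snd w))"
      using cost_lipschitz[of "lam k"] lam[of k] K_sub
      by (intro lipschitz_on_continuous_on[OF lipschitz_on_subset]) auto
    moreover have \<phi>_cont: "continuous_on K \<phi>" using lipschitz by (rule lipschitz_on_continuous_on)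
    have "continuous_on (K \<times> K) (\<lambda>w. \<phi> (fst w))" "continuous_on (K \<times> K) (\<lambda>w. \<phi> (snd w))"
      by (auto intro!: continuous_on_compose2[OF \<phi>_cont] continuous_intros)
    ultimately have "closed (F k)"
      unfolding F_def by (intro continuous_on_closed_Collect_le compact_imp_closed[OF KK] continuous_intros)
    moreover have "F k = (K \<times> K) \<inter> F k" by (auto simp: F_def)
    ultimately show "compact (F k)" using compact_Int_closed[OF KK] by metis
    obtain x y where xy: "x \<in> K" "y \<in> K" "(L + \<epsilon>) * cost (lam k) x y < \<bar>\<phi> y - \<phi> x\<bar>"
      using neg lam(2)[of k] by (meson not_le)
    have "\<delta> \<le> cost (lam k) x y"
    proof (rule ccontr)
      assume "\<not> ?thesis"
      then show False using local[OF lam(1)[of k] xy(1,2)] xy(3) by simp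
    qed
    then have "(x, y) \<in> F k" using xy by (simp add: F_def max_absorb2)
    then show "F k \<noteq> {}" by blast
  next
    fix m n :: nat assume "m \<le> n"
    show "F n \<subseteq> F m"
    proof
      fix w assume w: "w \<in> F n"
      then have "fst w \<in> slab T" "snd w \<in> slab T" using K_sub by (auto simp: F_def)
      then have "cost (lam m) (fst w) (snd w) \<le> cost (lam n) (fst w) (snd w)"
        using cost_antimono lam_antimono[OF \<open>m \<le> n\<close>] lam(1)[of n] by auto
      then have "(L + \<epsilon>) * max \<delta> (cost (lam m) (fst w) (snd w)) \<le> (L + \<epsilon>) * max \<delta> (cost (lam n) (fst w) (snd w))"
        using L_pos \<epsilon>_pos by (intro mult_left_mono) auto
      then show "w \<in> F m" using w by (auto simp: F_def)
    qed
  qed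
  then obtain w where w: "\<And>k. w \<in> F k" by blast
  define x where "x = fst w"
  define y where "y = snd w"
  define D where "D = \<bar>\<phi> y - \<phi> x\<bar>"
  have xy: "x \<in> K" "y \<in> K" using w[of 0] by (auto simp: F_def x_def y_def)
  then have slab: "x \<in> slab T" "y \<in> slab T" using K_sub by auto
  have F_le: "(L + \<epsilon>) * max \<delta> (cost (lam k) x y) \<le> D" for k
    using w[of k] by (simp add: F_def x_def y_def D_def)
  have "(L + \<epsilon>) * \<delta> \<le> (L + \<epsilon>) * max \<delta> (cost (lam 0) x y)"
    using L_pos \<epsilon>_pos by (intro mult_left_mono) auto
  then have "D > 0" using F_le[of 0] L_pos \<epsilon>_pos \<open>\<delta> > 0\<close> by (smt (verit) mult_pos_pos)
  have cost_D: "cost (lam k) x y \<le> D / (L + \<epsilon>)" for k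
  proof -
    have "(L + \<epsilon>) * cost (lam k) x y \<le> (L + \<epsilon>) * max \<delta> (cost (lam k) x y)"
      using L_pos \<epsilon>_pos by (intro mult_left_mono) auto
    then have "(L + \<epsilon>) * cost (lam k) x y \<le> D" using F_le[of k] by (rule order_trans)
    then show ?thesis using L_pos \<epsilon>_pos by (simp add: le_divide_eq mult.commute)
  qed
  \<comment> \<open>The bound passes to the supremum because \<open>lam k\<close> tends to
    \<open>0\<close> and the cost decreases in \<open>lam\<close>. With the directional hypothesis
    it yields \<open>D \<le> L * D / (L + \<epsilon>)\<close>, impossible for
    \<open>D > 0\<close>.\<close>
  have "dist_zero T v P Z x y \<le> ennreal (D / (L + \<epsilon>))"
    unfolding dist_zero_def
  proof (rule SUP_least)
    fix l :: real assume l: "l \<in> {0<..1}"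
    obtain k where "lam0 / l < real k" using reals_Archimedean2 by blast
    then have "lam k \<le> l" using l lam0 by (simp add: lam_def field_simps)
    then have "cost l x y \<le> cost (lam k) x y" using lam(1)[of k] slab by (intro cost_antimono) auto
    then show "dist_lam T v P Z l x y \<le> ennreal (D / (L + \<epsilon>))"
      using cost_D[of k] l by (simp add: dist_lam_eq_cost[OF slab] ennreal_leI)
  qed
  then have "ennreal L * dist_zero T v P Z x y \<le> ennreal L * ennreal (D / (L + \<epsilon>))"
    by (intro mult_left_mono) auto
  moreover have "ennreal D \<le> ennreal L * dist_zero T v P Z x y"
    using directional xy by (auto simp: directionally_lipschitz_on_def D_def)
  ultimately have "ennreal D \<le> ennreal L * ennreal (D / (L + \<epsilon>))"
    by (rule order_trans[rotated])
  then have "ennreal D \<le> ennreal (L * (D / (L + \<epsilon>)))"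
    by (subst ennreal_mult') (use L_pos in auto)
  then have "D \<le> L * (D / (L + \<epsilon>))" using L_pos \<epsilon>_pos \<open>D > 0\<close> by (subst (asm) ennreal_le_iff) auto
  then have "D * (L + \<epsilon>) \<le> L * D" using L_pos \<epsilon>_pos by (simp add: le_divide_eq)
  then have "D * \<epsilon> \<le> 0" by (simp add: algebra_simps)
  then show False using \<open>D > 0\<close> \<epsilon>_pos by (simp add: mult_le_0_iff)
qed

lemma extension_exists:
  "\<exists>\<psi>. (\<forall>x\<in>K. \<psi> x = \<phi> x) \<and> (\<exists>C. C-lipschitz_on (slab T) \<psi>) \<and>
    directionally_lipschitz_on T v P Z (L + \<epsilon>) (slab T) \<psi>"
proof (cases "K = {}")
  \<comment> \<open>An empty tube is treated apart, since the infimum defining the extension ranges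
    over \<open>K\<close>; a constant function serves.\<close>
  case True
  then show ?thesis
    by (intro exI[of _ "\<lambda>_. 0"]) (auto simp: directionally_lipschitz_on_def intro: lipschitz_on_constant)
next
  case False
  then obtain k0 where k0: "k0 \<in> K" by blast
  define N where "N = L + \<epsilon>"
  have "N > 0" using L_pos \<epsilon>_pos by (simp add: N_def)
  obtain lam where lam: "lam \<in> {0<..1}" "lam > 0"
    and lip: "\<And>x y. x \<in> K \<Longrightarrow> y \<in> K \<Longrightarrow> \<bar>\<phi> y - \<phi> x\<bar> \<le> N * cost lam x y"
    using lipschitz_for_cost unfolding N_def by auto
  \<comment> \<open>The McShane formula for the pseudometric \<open>N * cost lam\<close>.\<close>
  define \<psi> where "\<psi> x = (INF k\<in>K. \<phi> k + N * cost lam x k)" for x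
  have tri: "N * cost lam x z \<le> N * cost lam x y + N * cost lam y z"
    if "x \<in> slab T" "y \<in> slab T" "z \<in> slab T" for x y z
    using cost_triangle[OF that lam(2)] \<open>N > 0\<close> by (simp flip: distrib_left)
  \<comment> \<open>The lower bound comes from the estimate between a fixed \<open>k0\<close> and
    the varying \<open>k\<close>, routed through \<open>x\<close> by the triangle
    inequality.\<close>
  have bdd: "bdd_below ((\<lambda>k. \<phi> k + N * cost lam x k) ` K)" if "x \<in> slab T" for x
  proof (rule bdd_belowI2[of _ "\<phi> k0 - N * cost lam k0 x"])
    fix k assume "k \<in> K"
    then have "k0 \<in> slab T" "k \<in> slab T" using k0 K_sub by blast+
    then show "\<phi> k0 - N * cost lam k0 x \<le> \<phi> k + N * cost lam x k"
      using lip[OF k0 \<open>k \<in> K\<close>] tri[of k0 x k] that by linarith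
  qed
  have half: "\<psi> x \<le> \<psi> y + N * cost lam x y" if "x \<in> slab T" "y \<in> slab T" for x y
  proof -
    have "\<psi> x - N * cost lam x y \<le> \<psi> y"
      unfolding \<psi>_def[of y]
    proof (rule cINF_greatest[OF False])
      fix k assume "k \<in> K"
      then have "\<psi> x \<le> \<phi> k + N * cost lam x k"
        unfolding \<psi>_def using bdd[OF that(1)] by (intro cINF_lower)
      moreover have "k \<in> slab T" using \<open>k \<in> K\<close> K_sub by blast
      ultimately show "\<psi> x - N * cost lam x y \<le> \<phi> k + N * cost lam y k"
        using tri[of x y k] that by linarith
    qed
    then show ?thesis by simp
  qed
  have \<psi>_lip: "\<bar>\<psi> y - \<psi> x\<bar> \<le> N * cost lam x y" if "x \<in> slab T" "y \<in> slab T" for x y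
    using half[OF that] half[OF that(2,1)] cost_sym[of lam x y] by (simp add: abs_le_iff)
  have "\<psi> x = \<phi> x" if "x \<in> K" for x
  proof (rule antisym)
    have "x \<in> slab T" using K_sub that by blast
    have "cost lam x x \<le> 0" using cost_le_norm[OF \<open>x \<in> slab T\<close> \<open>x \<in> slab T\<close> lam(2)] by simp
    then have "cost lam x x = 0" using cost_nonneg[OF \<open>x \<in> slab T\<close> \<open>x \<in> slab T\<close> lam(2)] by simp
    moreover have "\<psi> x \<le> \<phi> x + N * cost lam x x"
      unfolding \<psi>_def using bdd[OF \<open>x \<in> slab T\<close>] that by (intro cINF_lower)
    ultimately show "\<psi> x \<le> \<phi> x" by simp
    show "\<phi> x \<le> \<psi> x"
      unfolding \<psi>_def
    proof (rule cINF_greatest[OF False])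
      fix k assume "k \<in> K"
      then show "\<phi> x \<le> \<phi> k + N * cost lam x k" using lip[OF that \<open>k \<in> K\<close>] by linarith
    qed
  qed
  moreover have "(N * (1 + (1 + V) / lam))-lipschitz_on (slab T) \<psi>"
  proof (rule lipschitz_onI)
    fix x y :: "real \<times> (real ^ 'n)"
    assume xy: "x \<in> slab T" "y \<in> slab T"
    have "\<bar>\<psi> x - \<psi> y\<bar> \<le> N * cost lam y x" by (rule \<psi>_lip[OF xy(2,1)])
    also have "\<dots> \<le> N * ((1 + (1 + V) / lam) * norm (x - y))"
      using cost_le_norm[OF xy(2,1) lam(2)] \<open>N > 0\<close> by simp
    finally show "dist (\<psi> x) (\<psi> y) \<le> N * (1 + (1 + V) / lam) * dist x y"
      by (simp add: dist_real_def dist_norm mult.assoc)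
  qed (use \<open>N > 0\<close> V_ge_1 lam(2) in simp)
  moreover have "directionally_lipschitz_on T v P Z N (slab T) \<psi>"
    unfolding directionally_lipschitz_on_def
  proof (intro ballI)
    fix x y :: "real \<times> (real ^ 'n)"
    assume xy: "x \<in> slab T" "y \<in> slab T"
    have "ennreal \<bar>\<psi> y - \<psi> x\<bar> \<le> ennreal (N * cost lam x y)"
      by (rule ennreal_leI[OF \<psi>_lip[OF xy]])
    also have "\<dots> = ennreal N * ennreal (cost lam x y)" using \<open>N > 0\<close> by (simp add: ennreal_mult')
    also have "\<dots> \<le> ennreal N * dist_zero T v P Z x y"
      by (intro mult_left_mono cost_le_dist_zero xy lam(1)) simp
    finally show "ennreal \<bar>\<psi> y - \<psi> x\<bar> \<le> ennreal N * dist_zero T v P Z x y" .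
  qed
  ultimately show ?thesis unfolding N_def by blast
qed

end

theorem theorem4p3:
  fixes T L M \<epsilon> :: real
    and v :: "real \<times> (real ^ 'n) \<Rightarrow> real \<times> (real ^ 'n)"
    and P A :: "'a::topological_space set"
    and Z :: "real \<times> 'a \<Rightarrow> real \<times> (real ^ 'n)"
    and \<phi> :: "real \<times> (real ^ 'n) \<Rightarrow> real"
  assumes "T > 0" and "L > 0" and "M > 0" and "\<epsilon> > 0"
    and "bounded_Borel_field T v"
    and "\<forall>x\<in>slab T. fst (v x) = 1"
    and "space_unif_continuous T v"
    and "multi_flow T v P Z"
    and "slab T \<subseteq> closure (Z ` ({0..T} \<times> P))"
    and "A \<subseteq> P"
    and "compact (flow_tube T Z A)"
    and "\<phi> \<in> borel_measurable (restrict_space borel (flow_tube T Z A))"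
    and "M-lipschitz_on (flow_tube T Z A) \<phi>"
    and "directionally_lipschitz_on T v P Z L (flow_tube T Z A) \<phi>"
  shows "\<exists>\<psi>. (\<forall>x\<in>flow_tube T Z A. \<psi> x = \<phi> x) \<and>
             (\<exists>C. C-lipschitz_on (slab T) \<psi>) \<and>
             directionally_lipschitz_on T v P Z (L + \<epsilon>) (slab T) \<psi>"
proof -
  interpret directional_extension T v P Z A \<phi> L M \<epsilon>
    using assms by unfold_locales
  show ?thesis by (rule extension_exists)
qed

end
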